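(* Consider the system described in the context with the polytopic representation and slope-restriction assumption given there, and assume that $E(p)=\bar E$ for all $p\in\mathbb{P}$ for some non-singular $\bar E\in\mathbb{R}^{n_x\times n_x}$, and that $\{\boldsymbol{e}_i\}_{i\in\mathcal{N}}\subset\xi(\mathbb{P})$, where $\xi=(\xi_1,\dots,\xi_N)$ and $\boldsymbol{e}_i$ is the $i$-th unit vector of $\mathbb{R}^N$. There exists an observer of the form in the context, with some gains $L:\mathbb{P}\times\mathbb{P}\to\mathbb{R}^{n_x\times n_y}$ and $K:\mathbb{P}\times\mathbb{P}\to\mathbb{R}^{n_\phi\times n_y}$, that renders the error dynamics absolutely poly-quadratically ISS with respect to $v$, $w$ and $\psi$, if and only if there exist matrices $P_i\in\mathbb{S}^{n_x}$, $X_{ij}\in\mathbb{R}^{n_x\times n_x}$, $Y_{ij}\in\mathbb{R}^{n_x\times n_y}$, $Z_{ij}\in\mathbb{R}^{n_\phi\times n_y}$ and scalars $\tau_{ij},\kappa_v,\kappa_w,\kappa_\psi\in\mathbb{R}_{>0}$, $i,j\in\mathcal{N}$, such that for all $i,j\in\mathcal{N}$ $$\begin{bmatrix} \operatorname{He}(X_{ij}\bar E)-P_j & \star & \star & \star & \star & \star\\ (X_{ij}A_i-Y_{ij}C)^\top & P_i-I & \star & \star & \star & \star\\ -(X_{ij}G_i)^\top & \Lambda(\tau_{ij}H-Z_{ij}C) & 2\tau_{ij}I & \star & \star & \star\\ -(X_{ij}F_i)^\top & 0 & 0 & \kappa_v I & \star & \star\\ (Y_{ij}D)^\top & 0 & (\Lambda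 Z_{ij}D)^\top & 0 & \kappa_w I & \star\\ X_{ij}^\top & 0 & 0 & 0 & 0 & \kappa_\psi I \end{bmatrix}\succ 0 .$$ In fact, in that case $P_i\succ0$ and the matrices $X_{ij}$ are non-singular, $i,j\in\mathcal{N}$, and the observer with $$L(\hat p_+,\hat p)=\sum_{i\in\mathcal{N}}\xi_i(\hat p)X_i^{-1}(\hat p_+)Y_i(\hat p_+),\qquad [X_i(\hat p_+)\ \ Y_i(\hat p_+)]=\sum_{j\in\mathcal{N}}\xi_j(\hat p_+)[X_{ij}\ \ Y_{ij}],$$ $$K(\hat p_+,\hat p)=\frac{\sum_{i,j\in\mathcal{N}}\xi_i(\hat p)\xi_j(\hat p_+)Z_{ij}}{\sum_{i,j\in\mathcal{N}}\xi_i(\hat p)\xi_j(\hat p_+)\tau_{ij}},\qquad \hat p_+,\hat p\in\mathbb{P},$$ renders the error dynamics absolutely poly-quadratically ISS with respect to $v$, $w$ and $\psi$, and, with $\underline{\sigma}:=\sigma_{\min}(\bar E)$, the ISS estimate holds with $\beta(s,r):=\sqrt{\kappa_\psi}\,\underline{\sigma}\sqrt{\rho^r}\,s$ for some $\rho\in(0,1)$, $\gamma_v(s):=\sqrt{\kappa_\psi\kappa_v}\,\underline{\sigma}s$, $\gamma_w(s):=\sqrt{\kappa_\psi\kappa_w}\,\underline{\sigma}s$ and $\gamma_\psi(s):=\kappa_\psi\underline{\sigma}s$, $r,s\in\mathbb{R}_{\geqslant0}$. Moreover, $V(e,\hat p)=\sum_{i\in\mathcal{N}}e^\top\xi_i(\hat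 p)P_ie$ is a poly-quadratic ISS-Lyapunov function for the error dynamics, satisfying the bounds in its definition with $a=\kappa_\psi\underline{\sigma}^2>1$ and with the scalars $\kappa_v,\kappa_w,\kappa_\psi$ from the matrix inequalities.
   Context: Notation. $\mathbb{S}^n$ is the set of symmetric real $n\times n$ matrices; $M\succ0$ means positive definite; $\operatorname{He}(A)=A+A^\top$; $\sigma_{\min}(A)$ is the smallest singular value of $A$; $\star$ completes a symmetric matrix; $\|\cdot\|$ is the Euclidean norm; $\|x\|_{\infty,k}=\max_{0\le j\le k}\|x_j\|$ (with $\|x\|_{\infty,-1}$ read as $0$); $\ell_\infty^n$ is the space of bounded sequences in $\mathbb{R}^n$ indexed by $\mathbb{N}=\{0,1,2,\dots\}$. $\mathcal{K}$: continuous strictly increasing $\alpha:\mathbb{R}_{\geqslant0}\to\mathbb{R}_{\geqslant0}$ with $\alpha(0)=0$. $\mathcal{KL}$: continuous $\beta:\mathbb{R}_{\geqslant0}\times\mathbb{R}_{\geqslant0}\to\mathbb{R}_{\geqslant0}$ with $\beta(\cdot,s)\in\mathcal{K}$ for each $s$, and $\beta(r,\cdot)$ non-increasing with $\beta(r,s)\to0$ as $s\to\infty$ for each $r$. System. For $k\in\mathbb{N}$, $$E(p_{k+1})x_{k+1}=A(p_k)x_k+G(p_k)\phi(Hx_k)+B(p_k)u_k+F(p_k)v_k,\qquad y_k=Cx_k+Dw_k,$$ with state $x_k\in\mathbb{R}^{n_x}$, input $u_k\in\mathbb{R}^{n_u}$, output $y_k\in\mathbb{R}^{n_y}$, process noise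 $v_k\in\mathbb{R}^{n_v}$, measurement noise $w_k\in\mathbb{R}^{n_w}$, parameter $p_k\in\mathbb{P}$, where $\mathbb{P}\subset\mathbb{R}^{n_p}$ is compact. $E,A,G,B,F$ are matrix-valued functions on $\mathbb{P}$ of sizes $n_x\times n_x$, $n_x\times n_x$, $n_x\times n_\phi$, $n_x\times n_u$, $n_x\times n_v$; $H\in\mathbb{R}^{n_\phi\times n_x}$, $C\in\mathbb{R}^{n_y\times n_x}$, $D\in\mathbb{R}^{n_y\times n_w}$ are constant; $\phi:\mathbb{R}^{n_\phi}\to\mathbb{R}^{n_\phi}$. Polytopic assumption. With $\mathcal{N}=\{1,\dots,N\}$, there are functions $\xi_i:\mathbb{P}\to\mathbb{R}_{\geqslant0}$, $i\in\mathcal{N}$, with $\sum_{i\in\mathcal N}\xi_i(p)=1$ for all $p\in\mathbb{P}$, and matrices $E_i,A_i,B_i,F_i,G_i$ such that $[E(p)\ A(p)\ B(p)\ F(p)\ G(p)]=\sum_{i\in\mathcal{N}}\xi_i(p)[E_i\ A_i\ B_i\ F_i\ G_i]$ for all $p\in\mathbb{P}$. Slope-restriction assumption. There is a symmetric positive definite $\Lambda\in\mathbb{S}^{n_\phi}$ such that $2\|\phi(y)-\phi(x)\|^2-2(\phi(y)-\phi(x))^\top\Lambda(y-x)\le0$ for all $x,y\in\mathbb{R}^{n_\phi}$. Observer. Given estimates $\hat p_k\in\mathbb{P}$, $$E(\hat p_{k+1})\hat x_{k+1}=A(\hat p_k)\hat x_k-L(\hat p_{k+1},\hat p_k)(C\hat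 x_k-y_k)+B(\hat p_k)u_k+G(\hat p_k)\phi\big(H\hat x_k-K(\hat p_{k+1},\hat p_k)(C\hat x_k-y_k)\big),$$ with gains $L:\mathbb{P}\times\mathbb{P}\to\mathbb{R}^{n_x\times n_y}$, $K:\mathbb{P}\times\mathbb{P}\to\mathbb{R}^{n_\phi\times n_y}$. Error dynamics. With $e_k=\hat x_k-x_k$, $$E(\hat p_{k+1})e_{k+1}=(A(\hat p_k)-L(\hat p_{k+1},\hat p_k)C)e_k+G(\hat p_k)\tilde\phi_k-F(\hat p_k)v_k+L(\hat p_{k+1},\hat p_k)Dw_k+\psi_k,$$ where $\tilde\phi_k=\tilde\phi(\hat p_{k+1},\hat p_k,e_k,x_k,w_k)$ with $\tilde\phi(\hat p_+,\hat p,e,x,w)=\phi\big((H-K(\hat p_+,\hat p)C)e+K(\hat p_+,\hat p)Dw+Hx\big)-\phi(Hx)$, and the model mismatch is $\psi_k=-(E(\hat p_{k+1})-E(p_{k+1}))x_{k+1}+(A(\hat p_k)-A(p_k))x_k+(B(\hat p_k)-B(p_k))u_k+(G(\hat p_k)-G(p_k))\phi(Hx_k)+(F(\hat p_k)-F(p_k))v_k$. ISS. The error dynamics are ISS with respect to $v,w,\psi$ if there are $\beta\in\mathcal{KL}$, $\gamma_v,\gamma_w,\gamma_\psi\in\mathcal{K}$ such that for all $e_0\in\mathbb{R}^{n_x}$, $v\in\ell_\infty^{n_v}$, $w\in\ell_\infty^{n_w}$, $\psi\in\ell_\infty^{n_x}$ and sequences $p_k,\hat p_k\in\mathbb{P}$,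 the ISS estimate $\|e_k\|\le\beta(\|e_0\|,k)+\gamma_v(\|v\|_{\infty,k-1})+\gamma_w(\|w\|_{\infty,k-1})+\gamma_\psi(\|\psi\|_{\infty,k-1})$ holds for all $k\in\mathbb{N}$. Absolute poly-quadratic ISS. The error dynamics are absolutely poly-quadratically ISS with respect to $v,w,\psi$ if they admit a poly-quadratic ISS-Lyapunov function, i.e. a function $V:\mathbb{R}^{n_x}\times\mathbb{P}\to\mathbb{R}_{\geqslant0}$ of the form $V(e,\hat p)=\sum_{i\in\mathcal{N}}e^\top\xi_i(\hat p)P_ie$ with $P_i\in\mathbb{S}^{n_x}$, such that for some $a\ge1$ and $\kappa_v,\kappa_w,\kappa_\psi>0$ $$\|e\|^2\le V(e,\hat p)\le a\|e\|^2,\qquad V(e_+,\hat p_+)-V(e,\hat p)\le-\|e\|^2+\kappa_v\|v\|^2+\kappa_w\|w\|^2+\kappa_\psi\|\psi\|^2$$ for all $\tilde\phi(\hat p_+,\hat p,e,x,w)=\phi\big((H-K(\hat p_+,\hat p)C)e+K(\hat p_+,\hat p)Dw+Hx\big)-\phi(Hx)$ with $\phi$ any function satisfying the slope-restriction assumption (with the given $\Lambda$), all $\hat p_+,\hat p\in\mathbb{P}$, $e,x,\psi\in\mathbb{R}^{n_x}$, $v\in\mathbb{R}^{n_v}$, $w\in\mathbb{R}^{n_w}$, where $e_+$ satisfies $E(\hat p_+)e_+=(A(\hat p)-L(\hat p_+,\hat p)C)e+G(\hat p)\tilde\phi(\hat p_+,\hat p,e,x,w)-F(\hat p)v+L(\hat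 p_+,\hat p)Dw+\psi$.
   Formalization: The bounds with σ_min(Ē) fail for some solutions (e.g. Ē=diag(1,10)); proved instead: a, β, γ_v, γ_w, γ_ψ with σ_max(Ē) for every solution, κ_ψσ_min(Ē)²>1, and the σ_min bounds for the same matrices once κ_ψ is replaced by any sufficiently large value. *)

theory Defs
  imports "HOL-Analysis.Analysis"
begin

section \<open>Matrices\<close>

text \<open>An \<open>m\<close>-by-\<open>n\<close> matrix has type \<open>real^'n^'m\<close> (rows are indexed by \<open>'m\<close>).\<close>

definition sym_mat :: "real^'n^'n \<Rightarrow> bool" where
  "sym_mat M \<longleftrightarrow> transpose M = M"

definition pos_def :: "real^'n^'n \<Rightarrow> bool" where
  "pos_def M \<longleftrightarrow> sym_mat M \<and> (\<forall>z. z \<noteq> 0 \<longrightarrow> z \<bullet> (M *v z) > 0)"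

definition He :: "real^'n^'n \<Rightarrow> real^'n^'n" where
  "He M = M + transpose M"

definition singular_values :: "real^'n^'n \<Rightarrow> real set" where
  "singular_values M = {s. s \<ge> 0 \<and> (\<exists>z. z \<noteq> 0 \<and> (transpose M ** M) *v z = s\<^sup>2 *\<^sub>R z)}"

definition sigma_min :: "real^'n^'n \<Rightarrow> real" where
  "sigma_min M = Min (singular_values M)"

definition sigma_max :: "real^'n^'n \<Rightarrow> real" where
  "sigma_max M = Max (singular_values M)"

text \<open>Vertical concatenation, and the symmetric block matrix with lower triangle
  \<open>A\<close>, \<open>B\<close>, \<open>C\<close> (the upper right block is the transpose of \<open>B\<close>).\<close>

definition above :: "real^'c^'a \<Rightarrow> real^'c^'b \<Rightarrow> real^'c^('a + 'b)" (infixr "above" 60) where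
  "A above B = (\<chi> r. case r of Inl i \<Rightarrow> A $ i | Inr i \<Rightarrow> B $ i)"

definition sym_block :: "real^'a^'a \<Rightarrow> real^'a^'b \<Rightarrow> real^'b^'b \<Rightarrow> real^('a + 'b)^('a + 'b)" where
  "sym_block A B C = (\<chi> r c. case r of
     Inl i \<Rightarrow> (case c of Inl j \<Rightarrow> A $ i $ j | Inr j \<Rightarrow> transpose B $ i $ j)
   | Inr i \<Rightarrow> (case c of Inl j \<Rightarrow> B $ i $ j | Inr j \<Rightarrow> C $ i $ j))"


section \<open>The system\<close>

record ('np, 'nx, 'nu, 'ny, 'nv, 'nw, 'nf) lpv_system =
  pset :: "(real^'np) set"
  sE :: "real^'np \<Rightarrow> real^'nx^'nx"
  sA :: "real^'np \<Rightarrow> real^'nx^'nx"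
  sG :: "real^'np \<Rightarrow> real^'nf^'nx"
  sB :: "real^'np \<Rightarrow> real^'nu^'nx"
  sF :: "real^'np \<Rightarrow> real^'nv^'nx"
  sH :: "real^'nx^'nf"
  sC :: "real^'nx^'ny"
  sD :: "real^'nw^'ny"

text \<open>The index set of the polytopic representation is the finite type \<open>'i\<close>.\<close>

definition polytopic ::
  "('np, 'nx, 'nu, 'ny::finite, 'nv, 'nw::finite, 'nf) lpv_system \<Rightarrow> ('i::finite \<Rightarrow> real^'np \<Rightarrow> real) \<Rightarrow>
   ('i \<Rightarrow> real^'nx^'nx) \<Rightarrow> ('i \<Rightarrow> real^'nx^'nx) \<Rightarrow> ('i \<Rightarrow> real^'nu^'nx) \<Rightarrow>
   ('i \<Rightarrow> real^'nv^'nx) \<Rightarrow> ('i \<Rightarrow> real^'nf^'nx) \<Rightarrow> bool" where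
  "polytopic S \<xi> Ei Ai Bi Fi Gi \<longleftrightarrow>
     (\<forall>p\<in>pset S. (\<forall>i. \<xi> i p \<ge> 0) \<and> (\<Sum>i\<in>UNIV. \<xi> i p) = 1 \<and>
        sE S p = (\<Sum>i\<in>UNIV. \<xi> i p *\<^sub>R Ei i) \<and>
        sA S p = (\<Sum>i\<in>UNIV. \<xi> i p *\<^sub>R Ai i) \<and>
        sB S p = (\<Sum>i\<in>UNIV. \<xi> i p *\<^sub>R Bi i) \<and>
        sF S p = (\<Sum>i\<in>UNIV. \<xi> i p *\<^sub>R Fi i) \<and>
        sG S p = (\<Sum>i\<in>UNIV. \<xi> i p *\<^sub>R Gi i))"

definition slope_restricted :: "real^'nf^'nf \<Rightarrow> (real^'nf \<Rightarrow> real^'nf) \<Rightarrow> bool" where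
  "slope_restricted \<Lambda> \<phi> \<longleftrightarrow>
     (\<forall>x y. 2 * (norm (\<phi> y - \<phi> x))\<^sup>2 - 2 * ((\<phi> y - \<phi> x) \<bullet> (\<Lambda> *v (y - x))) \<le> 0)"

definition system_traj ::
  "('np, 'nx, 'nu, 'ny, 'nv, 'nw, 'nf) lpv_system \<Rightarrow> (real^'nf \<Rightarrow> real^'nf) \<Rightarrow>
   (nat \<Rightarrow> real^'np) \<Rightarrow> (nat \<Rightarrow> real^'nu) \<Rightarrow> (nat \<Rightarrow> real^'nv) \<Rightarrow> (nat \<Rightarrow> real^'nw) \<Rightarrow>
   (nat \<Rightarrow> real^'nx) \<Rightarrow> (nat \<Rightarrow> real^'ny) \<Rightarrow> bool" where
  "system_traj S \<phi> p u v w x y \<longleftrightarrow>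
     (\<forall>k. sE S (p (Suc k)) *v x (Suc k) =
            sA S (p k) *v x k + sG S (p k) *v \<phi> (sH S *v x k) + sB S (p k) *v u k
              + sF S (p k) *v v k
        \<and> y k = sC S *v x k + sD S *v w k)"


section \<open>Observer and error dynamics\<close>

definition observer_traj ::
  "('np, 'nx, 'nu, 'ny, 'nv::finite, 'nw::finite, 'nf) lpv_system \<Rightarrow> (real^'nf \<Rightarrow> real^'nf) \<Rightarrow>
   (real^'np \<Rightarrow> real^'np \<Rightarrow> real^'ny^'nx) \<Rightarrow> (real^'np \<Rightarrow> real^'np \<Rightarrow> real^'ny^'nf) \<Rightarrow>
   (nat \<Rightarrow> real^'np) \<Rightarrow> (nat \<Rightarrow> real^'nu) \<Rightarrow> (nat \<Rightarrow> real^'ny) \<Rightarrow> (nat \<Rightarrow> real^'nx) \<Rightarrow> bool" where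
  "observer_traj S \<phi> L K ph u y xh \<longleftrightarrow>
     (\<forall>k. sE S (ph (Suc k)) *v xh (Suc k) =
            sA S (ph k) *v xh k - L (ph (Suc k)) (ph k) *v (sC S *v xh k - y k) + sB S (ph k) *v u k
            + sG S (ph k) *v \<phi> (sH S *v xh k - K (ph (Suc k)) (ph k) *v (sC S *v xh k - y k)))"

definition mismatch ::
  "('np, 'nx, 'nu, 'ny::finite, 'nv, 'nw::finite, 'nf) lpv_system \<Rightarrow> (real^'nf \<Rightarrow> real^'nf) \<Rightarrow>
   (nat \<Rightarrow> real^'np) \<Rightarrow> (nat \<Rightarrow> real^'np) \<Rightarrow> (nat \<Rightarrow> real^'nu) \<Rightarrow> (nat \<Rightarrow> real^'nv) \<Rightarrow>
   (nat \<Rightarrow> real^'nx) \<Rightarrow> nat \<Rightarrow> real^'nx" where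
  "mismatch S \<phi> p ph u v x k =
     - ((sE S (ph (Suc k)) - sE S (p (Suc k))) *v x (Suc k)) + (sA S (ph k) - sA S (p k)) *v x k
     + (sB S (ph k) - sB S (p k)) *v u k + (sG S (ph k) - sG S (p k)) *v \<phi> (sH S *v x k)
     + (sF S (ph k) - sF S (p k)) *v v k"

definition phi_tilde ::
  "('np, 'nx, 'nu::finite, 'ny, 'nv::finite, 'nw, 'nf) lpv_system \<Rightarrow> (real^'nf \<Rightarrow> real^'nf) \<Rightarrow>
   (real^'np \<Rightarrow> real^'np \<Rightarrow> real^'ny^'nf) \<Rightarrow>
   real^'np \<Rightarrow> real^'np \<Rightarrow> real^'nx \<Rightarrow> real^'nx \<Rightarrow> real^'nw \<Rightarrow> real^'nf" where
  "phi_tilde S \<phi> K pp p e x w =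
     \<phi> ((sH S - K pp p ** sC S) *v e + (K pp p ** sD S) *v w + sH S *v x) - \<phi> (sH S *v x)"

text \<open>One step \<open>e \<mapsto> ep\<close> of the (implicit) error dynamics, with parameter estimates
  \<open>p\<close> (current) and \<open>pp\<close> (next).\<close>

definition error_step ::
  "('np, 'nx, 'nu::finite, 'ny, 'nv, 'nw, 'nf) lpv_system \<Rightarrow> (real^'nf \<Rightarrow> real^'nf) \<Rightarrow>
   (real^'np \<Rightarrow> real^'np \<Rightarrow> real^'ny^'nx) \<Rightarrow> (real^'np \<Rightarrow> real^'np \<Rightarrow> real^'ny^'nf) \<Rightarrow>
   real^'np \<Rightarrow> real^'np \<Rightarrow> real^'nx \<Rightarrow> real^'nv \<Rightarrow> real^'nw \<Rightarrow> real^'nx \<Rightarrow> real^'nx \<Rightarrow> real^'nx \<Rightarrow> bool" where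
  "error_step S \<phi> L K pp p x v w \<psi> e ep \<longleftrightarrow>
     sE S pp *v ep = (sA S p - L pp p ** sC S) *v e + sG S p *v phi_tilde S \<phi> K pp p e x w
                       - sF S p *v v + (L pp p ** sD S) *v w + \<psi>"

lemma observer_error_step:
  assumes "system_traj S \<phi> p u v w x y" and "observer_traj S \<phi> L K ph u y xh"
  shows "error_step S \<phi> L K (ph (Suc k)) (ph k) (x k) (v k) (w k) (mismatch S \<phi> p ph u v x k)
           (xh k - x k) (xh (Suc k) - x (Suc k))"
proof -
  let ?K = "K (ph (Suc k)) (ph k)" and ?L = "L (ph (Suc k)) (ph k)"
  have y: "y k = sC S *v x k + sD S *v w k"
    and x: "sE S (p (Suc k)) *v x (Suc k) =
            sA S (p k) *v x k + sG S (p k) *v \<phi> (sH S *v x k) + sB S (p k) *v u k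
              + sF S (p k) *v v k"
    using assms(1) by (auto simp: system_traj_def)
  have arg: "(sH S - ?K ** sC S) *v (xh k - x k) + (?K ** sD S) *v w k + sH S *v x k
             = sH S *v xh k - ?K *v (sC S *v xh k - y k)"
    by (simp add: y algebra_simps matrix_vector_mul_assoc[symmetric])
  show ?thesis
    using assms(2) x unfolding error_step_def phi_tilde_def arg observer_traj_def mismatch_def
    by (simp add: y algebra_simps matrix_vector_mul_assoc[symmetric])
qed


section \<open>Input-to-state stability\<close>

definition class_K :: "(real \<Rightarrow> real) \<Rightarrow> bool" where
  "class_K \<alpha> \<longleftrightarrow> continuous_on {0..} \<alpha> \<and> strict_mono_on {0..} \<alpha> \<and> \<alpha> 0 = 0"

definition class_KL :: "(real \<Rightarrow> real \<Rightarrow> real) \<Rightarrow> bool" where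
  "class_KL \<beta> \<longleftrightarrow> continuous_on ({0..} \<times> {0..}) (\<lambda>(r, s). \<beta> r s) \<and>
     (\<forall>s\<ge>0. class_K (\<lambda>r. \<beta> r s)) \<and>
     (\<forall>r\<ge>0. antimono_on {0..} (\<beta> r) \<and> (\<beta> r \<longlongrightarrow> 0) at_top)"

text \<open>\<open>sup_before x k\<close> is the maximum of \<open>norm (x j)\<close> over \<open>0 \<le> j \<le> k - 1\<close>, and \<open>0\<close> for \<open>k = 0\<close>.\<close>

definition sup_before :: "(nat \<Rightarrow> real^'n) \<Rightarrow> nat \<Rightarrow> real" where
  "sup_before x k = (if k = 0 then 0 else Max ((\<lambda>j. norm (x j)) ` {..<k}))"

text \<open>The mismatch \<open>\<psi>\<close> is an independent bounded input, and the state \<open>x\<close> of the observed system,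
  on which the nonlinear term depends, is an arbitrary signal; the true parameter
  acts on the error only through \<open>x\<close> and \<open>\<psi>\<close>.  By \<open>observer_error_step\<close> this
  covers the estimation errors of the observer.\<close>

definition iss_with ::
  "('np, 'nx, 'nu::finite, 'ny, 'nv::finite, 'nw::finite, 'nf) lpv_system \<Rightarrow> (real^'nf \<Rightarrow> real^'nf) \<Rightarrow>
   (real^'np \<Rightarrow> real^'np \<Rightarrow> real^'ny^'nx) \<Rightarrow> (real^'np \<Rightarrow> real^'np \<Rightarrow> real^'ny^'nf) \<Rightarrow>
   (real \<Rightarrow> real \<Rightarrow> real) \<Rightarrow> (real \<Rightarrow> real) \<Rightarrow> (real \<Rightarrow> real) \<Rightarrow> (real \<Rightarrow> real) \<Rightarrow> bool" where
  "iss_with S \<phi> L K \<beta> \<gamma>v \<gamma>w \<gamma>\<psi> \<longleftrightarrow>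
     class_KL \<beta> \<and> class_K \<gamma>v \<and> class_K \<gamma>w \<and> class_K \<gamma>\<psi> \<and>
     (\<forall>ph x v w \<psi> e.
        (\<forall>k. ph k \<in> pset S) \<and> bounded (range v) \<and> bounded (range w) \<and> bounded (range \<psi>) \<and>
        (\<forall>k. error_step S \<phi> L K (ph (Suc k)) (ph k) (x k) (v k) (w k) (\<psi> k) (e k) (e (Suc k)))
        \<longrightarrow> (\<forall>k. norm (e k) \<le> \<beta> (norm (e 0)) (real k) + \<gamma>v (sup_before v k)
                             + \<gamma>w (sup_before w k) + \<gamma>\<psi> (sup_before \<psi> k)))"

definition poly_quadratic ::
  "('i::finite \<Rightarrow> real^'np \<Rightarrow> real) \<Rightarrow> ('i \<Rightarrow> real^'nx^'nx) \<Rightarrow> real^'nx \<Rightarrow> real^'np \<Rightarrow> real" where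
  "poly_quadratic \<xi> P e p = (\<Sum>i\<in>UNIV. e \<bullet> ((\<xi> i p *\<^sub>R P i) *v e))"

text \<open>The decrease condition is absolute: it is required for every nonlinearity that is
  slope restricted with respect to \<open>\<Lambda>\<close>.\<close>

definition iss_lyapunov ::
  "('np, 'nx, 'nu::finite, 'ny, 'nv::finite, 'nw::finite, 'nf) lpv_system \<Rightarrow> real^'nf^'nf \<Rightarrow>
   (real^'np \<Rightarrow> real^'np \<Rightarrow> real^'ny^'nx) \<Rightarrow> (real^'np \<Rightarrow> real^'np \<Rightarrow> real^'ny^'nf) \<Rightarrow>
   (real^'nx \<Rightarrow> real^'np \<Rightarrow> real) \<Rightarrow> real \<Rightarrow> real \<Rightarrow> real \<Rightarrow> real \<Rightarrow> bool" where
  "iss_lyapunov S \<Lambda> L K V a \<kappa>v \<kappa>w \<kappa>\<psi> \<longleftrightarrow>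
     (\<forall>e. \<forall>p\<in>pset S. (norm e)\<^sup>2 \<le> V e p \<and> V e p \<le> a * (norm e)\<^sup>2) \<and>
     (\<forall>\<phi>. slope_restricted \<Lambda> \<phi> \<longrightarrow>
        (\<forall>pp\<in>pset S. \<forall>p\<in>pset S. \<forall>e x \<psi> v w ep. error_step S \<phi> L K pp p x v w \<psi> e ep \<longrightarrow>
           V ep pp - V e p \<le> - (norm e)\<^sup>2 + \<kappa>v * (norm v)\<^sup>2 + \<kappa>w * (norm w)\<^sup>2 + \<kappa>\<psi> * (norm \<psi>)\<^sup>2))"

definition abs_poly_quadratic_iss ::
  "('np, 'nx, 'nu::finite, 'ny, 'nv::finite, 'nw::finite, 'nf) lpv_system \<Rightarrow> real^'nf^'nf \<Rightarrow>
   ('i::finite \<Rightarrow> real^'np \<Rightarrow> real) \<Rightarrow>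
   (real^'np \<Rightarrow> real^'np \<Rightarrow> real^'ny^'nx) \<Rightarrow> (real^'np \<Rightarrow> real^'np \<Rightarrow> real^'ny^'nf) \<Rightarrow> bool" where
  "abs_poly_quadratic_iss S \<Lambda> \<xi> L K \<longleftrightarrow>
     (\<exists>P a \<kappa>v \<kappa>w \<kappa>\<psi>. (\<forall>i. sym_mat (P i)) \<and> a \<ge> 1 \<and> \<kappa>v > 0 \<and> \<kappa>w > 0 \<and> \<kappa>\<psi> > 0 \<and>
        iss_lyapunov S \<Lambda> L K (poly_quadratic \<xi> P) a \<kappa>v \<kappa>w \<kappa>\<psi>)"


section \<open>The matrix inequalities and the resulting observer\<close>

text \<open>The matrix is written column by column, from the diagonal downwards.\<close>

definition lmi_matrix ::
  "real^'nx^'nx \<Rightarrow> real^'nx^'nx \<Rightarrow> real^'nf^'nx \<Rightarrow> real^'nv^'nx \<Rightarrow>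
   real^'nx^'nf \<Rightarrow> real^'nx^'ny \<Rightarrow> real^'nw^'ny \<Rightarrow> real^'nf^'nf \<Rightarrow>
   real^'nx^'nx \<Rightarrow> real^'nx^'nx \<Rightarrow> real^'nx^'nx \<Rightarrow> real^'ny^'nx \<Rightarrow> real^'ny^'nf \<Rightarrow>
   real \<Rightarrow> real \<Rightarrow> real \<Rightarrow> real \<Rightarrow>
   real^('nx + 'nx + 'nf + 'nv + 'nw + 'nx)^('nx + 'nx + 'nf + 'nv + 'nw + 'nx)" where
  "lmi_matrix Ebar A G F H C D \<Lambda> P P' X Y Z \<tau> \<kappa>v \<kappa>w \<kappa>\<psi> =
     sym_block (He (X ** Ebar) - P')
       (transpose (X ** A - Y ** C) above - transpose (X ** G) above - transpose (X ** F)
          above transpose (Y ** D) above transpose X)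
    (sym_block (P - mat 1)
       ((\<Lambda> ** (\<tau> *\<^sub>R H - Z ** C)) above 0 above 0 above 0)
    (sym_block ((2 * \<tau>) *\<^sub>R mat 1)
       (0 above transpose (\<Lambda> ** Z ** D) above 0)
    (sym_block (\<kappa>v *\<^sub>R mat 1)
       (0 above 0)
    (sym_block (\<kappa>w *\<^sub>R mat 1)
       0
       (\<kappa>\<psi> *\<^sub>R mat 1)))))"

definition lmi_solution ::
  "('np::finite, 'nx, 'nu::finite, 'ny, 'nv, 'nw::finite, 'nf) lpv_system \<Rightarrow> real^'nf^'nf \<Rightarrow> real^'nx^'nx \<Rightarrow>
   ('i::finite \<Rightarrow> real^'nx^'nx) \<Rightarrow> ('i \<Rightarrow> real^'nf^'nx) \<Rightarrow> ('i \<Rightarrow> real^'nv^'nx) \<Rightarrow>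
   ('i \<Rightarrow> real^'nx^'nx) \<Rightarrow> ('i \<Rightarrow> 'i \<Rightarrow> real^'nx^'nx) \<Rightarrow> ('i \<Rightarrow> 'i \<Rightarrow> real^'ny^'nx) \<Rightarrow>
   ('i \<Rightarrow> 'i \<Rightarrow> real^'ny^'nf) \<Rightarrow> ('i \<Rightarrow> 'i \<Rightarrow> real) \<Rightarrow> real \<Rightarrow> real \<Rightarrow> real \<Rightarrow> bool" where
  "lmi_solution S \<Lambda> Ebar Ai Gi Fi P X Y Z \<tau> \<kappa>v \<kappa>w \<kappa>\<psi> \<longleftrightarrow>
     (\<forall>i. sym_mat (P i)) \<and> (\<forall>i j. \<tau> i j > 0) \<and> \<kappa>v > 0 \<and> \<kappa>w > 0 \<and> \<kappa>\<psi> > 0 \<and>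
     (\<forall>i j. pos_def (lmi_matrix Ebar (Ai i) (Gi i) (Fi i) (sH S) (sC S) (sD S) \<Lambda>
                       (P i) (P j) (X i j) (Y i j) (Z i j) (\<tau> i j) \<kappa>v \<kappa>w \<kappa>\<psi>))"

definition gain_L ::
  "('i::finite \<Rightarrow> real^'np \<Rightarrow> real) \<Rightarrow> ('i \<Rightarrow> 'i \<Rightarrow> real^'nx^'nx) \<Rightarrow> ('i \<Rightarrow> 'i \<Rightarrow> real^'ny^'nx) \<Rightarrow>
   real^'np \<Rightarrow> real^'np \<Rightarrow> real^'ny^'nx" where
  "gain_L \<xi> X Y pp p =
     (\<Sum>i\<in>UNIV. \<xi> i p *\<^sub>R
        (matrix_inv (\<Sum>j\<in>UNIV. \<xi> j pp *\<^sub>R X i j) ** (\<Sum>j\<in>UNIV. \<xi> j pp *\<^sub>R Y i j)))"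

definition gain_K ::
  "('i::finite \<Rightarrow> real^'np \<Rightarrow> real) \<Rightarrow> ('i \<Rightarrow> 'i \<Rightarrow> real^'ny^'nf) \<Rightarrow> ('i \<Rightarrow> 'i \<Rightarrow> real) \<Rightarrow>
   real^'np \<Rightarrow> real^'np \<Rightarrow> real^'ny^'nf" where
  "gain_K \<xi> Z \<tau> pp p =
     (1 / (\<Sum>i\<in>UNIV. \<Sum>j\<in>UNIV. \<xi> i p * \<xi> j pp * \<tau> i j)) *\<^sub>R
       (\<Sum>i\<in>UNIV. \<Sum>j\<in>UNIV. (\<xi> i p * \<xi> j pp) *\<^sub>R Z i j)"

text \<open>The quantitative guarantees, with the singular value \<open>\<sigma>\<close> of the descriptor matrix as a
  parameter.  The matrix inequalities give \<open>norm e ^ 2 < V e p < \<kappa>\<psi> * norm (Ebar *v e) ^ 2\<close> for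
  \<open>e \<noteq> 0\<close>, so that \<open>\<sigma>\<close> is the largest singular value in general; the smallest one is
  admissible once \<open>\<kappa>\<psi>\<close> is large enough.\<close>

definition iss_guarantee ::
  "('np, 'nx, 'nu::finite, 'ny, 'nv::finite, 'nw::finite, 'nf) lpv_system \<Rightarrow> (real^'nf \<Rightarrow> real^'nf) \<Rightarrow> real^'nf^'nf \<Rightarrow>
   ('i::finite \<Rightarrow> real^'np \<Rightarrow> real) \<Rightarrow>
   (real^'np \<Rightarrow> real^'np \<Rightarrow> real^'ny^'nx) \<Rightarrow> (real^'np \<Rightarrow> real^'np \<Rightarrow> real^'ny^'nf) \<Rightarrow>
   ('i \<Rightarrow> real^'nx^'nx) \<Rightarrow> real \<Rightarrow> real \<Rightarrow> real \<Rightarrow> real \<Rightarrow> bool" where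
  "iss_guarantee S \<phi> \<Lambda> \<xi> L K P \<kappa>v \<kappa>w \<kappa>\<psi> \<sigma> \<longleftrightarrow>
     (\<exists>\<rho>. 0 < \<rho> \<and> \<rho> < 1 \<and>
        iss_with S \<phi> L K
          (\<lambda>s r. sqrt \<kappa>\<psi> * \<sigma> * sqrt (\<rho> powr r) * s)
          (\<lambda>s. sqrt (\<kappa>\<psi> * \<kappa>v) * \<sigma> * s)
          (\<lambda>s. sqrt (\<kappa>\<psi> * \<kappa>w) * \<sigma> * s)
          (\<lambda>s. \<kappa>\<psi> * \<sigma> * s)) \<and>
     \<kappa>\<psi> * \<sigma>\<^sup>2 > 1 \<and>
     iss_lyapunov S \<Lambda> L K (poly_quadratic \<xi> P) (\<kappa>\<psi> * \<sigma>\<^sup>2) \<kappa>v \<kappa>w \<kappa>\<psi>"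

end

theory Submission
  imports Defs
begin

text \<open>
  Evaluated along the error dynamics, the matrix inequality at the vertices \<open>(i, j)\<close> is the
  dissipation inequality plus a multiple \<open>\<tau> i j\<close> of the sector inequality of the nonlinearity.
  It is affine in the quantities indexed by \<open>j\<close>, hence holds at every next parameter; averaging over
  \<open>i\<close> and convexity of the Lyapunov function give the decrease for the interpolated observer.
  Conversely, every point of the sector is attained by a linear nonlinearity of rank one, so that the
  absolute dissipation inequality at a pair of vertices is an implication between quadratic
  inequalities; the S-lemma provides the multiplier \<open>\<tau> i j\<close>, and \<open>X = P j ** matrix_inv Ebar\<close>
  undoes the Schur complement.
\<close>

section \<open>Symmetric block matrices\<close>

text \<open>Three points shape the details. The gain \<open>K\<close> is a quotient of averages
  because the sector inequality enters the form at \<open>(i, j)\<close> with weight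
  \<open>\<tau> i j\<close>: after summation only the averaged \<open>Z\<close> and the averaged
  \<open>\<tau>\<close> are left, and dividing one by the other restores a single sector inequality.
  In the converse the dissipation inequality is used only at parameters where \<open>\<xi>\<close>
  is a unit vector, which is where the assumption on the image of \<open>\<xi>\<close> enters. The
  multiplier must be positive and the conclusion strict; compactness of the unit sphere supplies the
  slack for both. The inequalities compare the Lyapunov function with the norm of
  \<open>Ebar *v e\<close>, hence with \<open>sigma_max Ebar\<close> times the norm of
  \<open>e\<close>. To reach \<open>sigma_min Ebar\<close>, the scalar \<kappa>\<psi> is enlarged:
  this adds a nonnegative multiple of a squared norm to the form, so \<open>P\<close>,
  \<open>X\<close>, \<open>Y\<close>, \<open>Z\<close>, \<open>\<tau>\<close> remain a solution and
  the observer does not change.\<close>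

lemma inner_transpose_mult:
  fixes M :: "real^'n^'m"
  shows "z \<bullet> (transpose M *v y) = y \<bullet> (M *v z)"
  by (metis dot_lmul_matrix inner_commute transpose_matrix_vector)

lemma uminus_matrix_vector_mult: "(- M) *v z = - (M *v z)" for M :: "real^'n^'m"
  by (metis diff_0 matrix_vector_mult_0 matrix_vector_mult_diff_rdistrib)

lemma sum_matrix_vector_mult: "(\<Sum>i\<in>I. M i) *v z = (\<Sum>i\<in>I. M i *v z)" for M :: "'i \<Rightarrow> real^'n^'m"
  by (induction I rule: infinite_finite_induct) (auto simp: algebra_simps)

lemma linear_matrix_vector_mult_compose: "linear (\<lambda>x. M *v f x)" if "linear f" for M :: "real^'n^'m"
  using linear_compose[OF that matrix_vector_mul_linear[of M]] by (simp add: o_def)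

lemma symmetric_inner:
  "sym_mat M \<Longrightarrow> x \<bullet> (M *v y) = y \<bullet> (M *v x)"
  by (metis inner_transpose_mult sym_mat_def)

section \<open>Block vectors and the quadratic form of a block matrix\<close>

definition join :: "real^'a \<Rightarrow> real^'b \<Rightarrow> real^('a + 'b)" where
  "join a b = (\<chi> r. case r of Inl i \<Rightarrow> a $ i | Inr i \<Rightarrow> b $ i)"

lemma join_exhaust: obtains a b where "z = join a b"
proof
  show "z = join (\<chi> i. z $ Inl i) (\<chi> i. z $ Inr i)"
    by (simp add: join_def vec_eq_iff split: sum.split)
qed

lemma sum_UNIV_sum:
  "(\<Sum>r\<in>UNIV. f r) = (\<Sum>i\<in>UNIV. f (Inl i)) + (\<Sum>i\<in>UNIV. f (Inr i))"
  for f :: "'a::finite + 'b::finite \<Rightarrow> 'c::comm_monoid_add"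
  by (simp add: UNIV_Plus_UNIV[symmetric] sum.Plus del: UNIV_Plus_UNIV)

lemma inner_join: "join a b \<bullet> join c d = a \<bullet> c + b \<bullet> d"
  by (simp add: inner_vec_def sum_UNIV_sum join_def)

lemma join_eq_0_iff: "join a b = 0 \<longleftrightarrow> a = 0 \<and> b = 0"
  by (auto simp: join_def vec_eq_iff split: sum.split)

lemma above_mult_vec: "(M above N) *v z = join (M *v z) (N *v z)"
  by (simp add: above_def join_def vec_eq_iff matrix_vector_mult_def split: sum.split)

lemma sym_block_mult_join:
  "sym_block M B N *v join a b = join (M *v a + transpose B *v b) (B *v a + N *v b)"
  by (simp add: sym_block_def join_def vec_eq_iff matrix_vector_mult_def sum_UNIV_sum
      transpose_def vector_matrix_mult_def split: sum.split)

lemma sym_block_form: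
  "join a b \<bullet> (sym_block M B N *v join a b) = a \<bullet> (M *v a) + 2 * (b \<bullet> (B *v a)) + b \<bullet> (N *v b)"
  unfolding sym_block_mult_join inner_join inner_add_right inner_transpose_mult by simp

lemma sym_mat_sym_block: "sym_mat (sym_block M B N) \<longleftrightarrow> sym_mat M \<and> sym_mat N"
proof
  assume s: "sym_mat (sym_block M B N)"
  have "M $ j $ i = M $ i $ j" for i j
    using arg_cong[OF s[unfolded sym_mat_def], of "\<lambda>Q. Q $ Inl i $ Inl j"]
    by (simp add: transpose_def sym_block_def)
  moreover have "N $ j $ i = N $ i $ j" for i j
    using arg_cong[OF s[unfolded sym_mat_def], of "\<lambda>Q. Q $ Inr i $ Inr j"]
    by (simp add: transpose_def sym_block_def)
  ultimately show "sym_mat M \<and> sym_mat N"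
    by (simp add: sym_mat_def vec_eq_iff transpose_def)
qed (auto simp: sym_mat_def vec_eq_iff transpose_def sym_block_def split: sum.split)

lemma sym_mat_He: "sym_mat (He M)"
  by (simp add: sym_mat_def He_def transpose_def vec_eq_iff)

lemma sym_mat_scaleR_1: "sym_mat (c *\<^sub>R mat 1)"
  by (simp add: sym_mat_def transpose_scalar)

lemma sym_mat_diff: "sym_mat M \<Longrightarrow> sym_mat N \<Longrightarrow> sym_mat (M - N)"
  by (simp add: sym_mat_def transpose_def vec_eq_iff)

lemma sym_mat_diff_1_iff: "sym_mat (M - mat 1) \<longleftrightarrow> sym_mat M"
  by (force simp: sym_mat_def transpose_def vec_eq_iff mat_def)

lemma sym_mat_scaleR: "sym_mat M \<Longrightarrow> sym_mat (c *\<^sub>R M)"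
  by (simp add: sym_mat_def transpose_scalar)

lemma sym_mat_sum: "(\<And>i. i \<in> I \<Longrightarrow> sym_mat (M i)) \<Longrightarrow> sym_mat (\<Sum>i\<in>I. M i)"
  by (simp add: sym_mat_def transpose_def vec_eq_iff)

lemma He_form: "z \<bullet> (He M *v z) = 2 * (z \<bullet> (M *v z))"
  unfolding He_def matrix_vector_mult_add_rdistrib inner_add_right inner_transpose_mult by simp

lemma scaleR_1_form: "z \<bullet> ((c *\<^sub>R mat 1) *v z) = c * (norm z)\<^sup>2" for z :: "real^'n"
  by (simp add: scaleR_matrix_vector_assoc[symmetric] power2_norm_eq_inner)

text \<open>Evaluated at the successor error, minus the error, the increment of the nonlinearity, and
  minus the three disturbances, the terms with \<open>X\<close> and \<open>Y = X ** L\<close> cancel by the error dynamics.\<close>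

definition lmi_form ::
  "real^'nx^'nx \<Rightarrow> real^'nx^'nx \<Rightarrow> real^'nf^'nx \<Rightarrow> real^'nv^'nx \<Rightarrow>
   real^'nx^'nf \<Rightarrow> real^'nx^'ny \<Rightarrow> real^'nw^'ny \<Rightarrow> real^'nf^'nf \<Rightarrow>
   real^'nx^'nx \<Rightarrow> real^'nx^'nx \<Rightarrow> real^'nx^'nx \<Rightarrow> real^'ny^'nx \<Rightarrow> real^'ny^'nf \<Rightarrow>
   real \<Rightarrow> real \<Rightarrow> real \<Rightarrow> real \<Rightarrow>
   real^'nx \<Rightarrow> real^'nx \<Rightarrow> real^'nf \<Rightarrow> real^'nv \<Rightarrow> real^'nw \<Rightarrow> real^'nx \<Rightarrow> real" where
  "lmi_form Ebar A G F H C D \<Lambda> P P' X Y Z \<tau> \<kappa>v \<kappa>w \<kappa>\<psi> z e s v w q =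
     2 * (z \<bullet> (X *v (Ebar *v z))) - z \<bullet> (P' *v z)
     + 2 * (z \<bullet> (X *v (A *v e) - Y *v (C *v e) - X *v (G *v s) - X *v (F *v v)
                 + Y *v (D *v w) + X *v q))
     + e \<bullet> (P *v e) - (norm e)\<^sup>2
     + 2 * (s \<bullet> (\<Lambda> *v (\<tau> *\<^sub>R (H *v e) - Z *v (C *v e) + Z *v (D *v w))))
     + 2 * \<tau> * (norm s)\<^sup>2 + \<kappa>v * (norm v)\<^sup>2 + \<kappa>w * (norm w)\<^sup>2 + \<kappa>\<psi> * (norm q)\<^sup>2"

lemma lmi_matrix_form:
  "join z (join e (join s (join v (join w q)))) \<bullet>
     (lmi_matrix Ebar A G F H C D \<Lambda> P P' X Y Z \<tau> \<kappa>v \<kappa>w \<kappa>\<psi>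
        *v join z (join e (join s (join v (join w q))))) =
   lmi_form Ebar A G F H C D \<Lambda> P P' X Y Z \<tau> \<kappa>v \<kappa>w \<kappa>\<psi> z e s v w q"
  unfolding lmi_matrix_def sym_block_form above_mult_vec inner_join scaleR_1_form lmi_form_def
    matrix_vector_mult_diff_rdistrib inner_diff_right He_form inner_transpose_mult
    uminus_matrix_vector_mult inner_minus_right
  by (simp add: inner_transpose_mult algebra_simps inner_add_right inner_diff_right
      power2_norm_eq_inner scaleR_matrix_vector_assoc[symmetric] matrix_vector_mul_assoc[symmetric])

text \<open>Positivity is kept apart from symmetry and stated for six separate vectors, so that
  later arguments can simply insert suitable blocks.\<close>

definition lmi_pos ::
  "real^'nx^'nx \<Rightarrow> real^'nx^'nx \<Rightarrow> real^'nf^'nx \<Rightarrow> real^'nv^'nx \<Rightarrow>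
   real^'nx^'nf \<Rightarrow> real^'nx^'ny \<Rightarrow> real^'nw^'ny \<Rightarrow> real^'nf^'nf \<Rightarrow>
   real^'nx^'nx \<Rightarrow> real^'nx^'nx \<Rightarrow> real^'nx^'nx \<Rightarrow> real^'ny^'nx \<Rightarrow> real^'ny^'nf \<Rightarrow>
   real \<Rightarrow> real \<Rightarrow> real \<Rightarrow> real \<Rightarrow> bool" where
  "lmi_pos Ebar A G F H C D \<Lambda> P P' X Y Z \<tau> \<kappa>v \<kappa>w \<kappa>\<psi> \<longleftrightarrow>
     (\<forall>z e s v w q. (z, e, s, v, w, q) \<noteq> (0, 0, 0, 0, 0, 0) \<longrightarrow>
        lmi_form Ebar A G F H C D \<Lambda> P P' X Y Z \<tau> \<kappa>v \<kappa>w \<kappa>\<psi> z e s v w q > 0)"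

lemma pos_def_lmi_matrix_iff:
  "pos_def (lmi_matrix Ebar A G F H C D \<Lambda> P P' X Y Z \<tau> \<kappa>v \<kappa>w \<kappa>\<psi>) \<longleftrightarrow>
     sym_mat P \<and> sym_mat (He (X ** Ebar) - P') \<and>
     lmi_pos Ebar A G F H C D \<Lambda> P P' X Y Z \<tau> \<kappa>v \<kappa>w \<kappa>\<psi>"
  (is "pos_def ?M \<longleftrightarrow> _ \<and> _ \<and> ?form")
proof -
  have "sym_mat ?M \<longleftrightarrow> sym_mat P \<and> sym_mat (He (X ** Ebar) - P')"
    by (auto simp: lmi_matrix_def sym_mat_sym_block sym_mat_scaleR_1 sym_mat_diff_1_iff)
  moreover have "(\<forall>y. y \<noteq> 0 \<longrightarrow> y \<bullet> (?M *v y) > 0) \<longleftrightarrow> ?form"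
    (is "?all \<longleftrightarrow> _")
  proof
    assume ?all
    then show ?form
      unfolding lmi_pos_def by (metis lmi_matrix_form join_eq_0_iff)
  next
    assume r: ?form
    show ?all
    proof -
      have "0 < y \<bullet> (?M *v y)" if "y \<noteq> 0" for y
      proof -
        obtain z e s v w q where y: "y = join z (join e (join s (join v (join w q))))"
          by (metis join_exhaust)
        with that have "(z, e, s, v, w, q) \<noteq> (0, 0, 0, 0, 0, 0)"
          by (auto simp: join_eq_0_iff)
        with r show ?thesis
          by (auto simp: lmi_pos_def y lmi_matrix_form)
      qed
      then show ?thesis
        by blast
    qed
  qed
  ultimately show ?thesis
    by (auto simp: pos_def_def)
qed

section \<open>Extremal singular values\<close>

lemma norm_matrix_vector_mult_scaleR: "norm (M *v (c *\<^sub>R z)) = \<bar>c\<bar> * norm (M *v z)"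
  for M :: "real^'n^'m"
  by (simp add: matrix_vector_mult_scaleR)

lemma linear_coefficient_zero:
  fixes b c :: real
  assumes "\<And>t. 2 * t * b + t\<^sup>2 * c \<ge> 0"
  shows "b = 0"
proof (rule ccontr)
  assume "b \<noteq> 0"
  \<comment> \<open>At \<open>t = - s * b\<close> the linear term is
    \<open>- 2 * s * b\<^sup>2\<close>, and \<open>s * c \<le> 1\<close> keeps the quadratic term
    below half of its size.\<close>
  define s where "s = 1 / (\<bar>c\<bar> + 1)"
  have s: "s > 0" "s * c \<le> 1"
    by (auto simp: s_def field_simps)
  have "0 \<le> 2 * (- s * b) * b + (- s * b)\<^sup>2 * c"
    using assms .
  also have "\<dots> = s * b\<^sup>2 * (s * c - 2)"
    by (simp add: power2_eq_square algebra_simps)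
  also have "\<dots> < 0"
    using s \<open>b \<noteq> 0\<close> by (intro mult_pos_neg) auto
  finally show False
    by simp
qed

text \<open>A zero of a semidefinite quadratic form lies in its kernel.\<close>

lemma extremal_imp_eigenvector:
  fixes M :: "real^'n^'m"
  assumes semidef: "\<And>y. c * ((norm (M *v y))\<^sup>2 - m\<^sup>2 * (norm y)\<^sup>2) \<ge> 0"
    and "c \<noteq> 0" and zero: "norm (M *v z) = m * norm z"
  shows "(transpose M ** M) *v z = m\<^sup>2 *\<^sub>R z"
proof -
  have "h \<bullet> ((transpose M ** M) *v z - m\<^sup>2 *\<^sub>R z) = 0" for h
  proof -
    \<comment> \<open>Half of the derivative of the form at \<open>z\<close> in direction
      \<open>h\<close>. The form vanishes at \<open>z\<close> and \<open>c\<close> times it has no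
      negative values, so this derivative is zero.\<close>
    define b where "b = (M *v z) \<bullet> (M *v h) - m\<^sup>2 * (z \<bullet> h)"
    have "2 * t * (c * b) + t\<^sup>2 * (c * ((norm (M *v h))\<^sup>2 - m\<^sup>2 * (norm h)\<^sup>2)) \<ge> 0" for t
    proof -
      have z0: "(M *v z) \<bullet> (M *v z) = m\<^sup>2 * (z \<bullet> z)"
        using arg_cong[OF zero, of "\<lambda>x. x\<^sup>2"] by (simp add: power2_norm_eq_inner power_mult_distrib)
      have "0 \<le> c * ((norm (M *v (z + t *\<^sub>R h)))\<^sup>2 - m\<^sup>2 * (norm (z + t *\<^sub>R h))\<^sup>2)"
        by (rule semidef)
      also have "(norm (M *v (z + t *\<^sub>R h)))\<^sup>2 - m\<^sup>2 * (norm (z + t *\<^sub>R h))\<^sup>2 =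
          2 * t * b + t\<^sup>2 * ((norm (M *v h))\<^sup>2 - m\<^sup>2 * (norm h)\<^sup>2)"
        unfolding power2_norm_eq_inner b_def
        by (simp add: matrix_vector_right_distrib matrix_vector_mult_scaleR inner_add_left
            inner_add_right z0 inner_commute power2_eq_square algebra_simps)
      finally show ?thesis
        by (simp add: algebra_simps)
    qed
    then have "c * b = 0"
      by (rule linear_coefficient_zero)
    then show ?thesis
      using \<open>c \<noteq> 0\<close>
      unfolding b_def matrix_vector_mul_assoc[symmetric] inner_transpose_mult inner_diff_right
      by (simp add: inner_commute)
  qed
  then have "(transpose M ** M) *v z - m\<^sup>2 *\<^sub>R z = 0"
    by (metis inner_eq_zero_iff)
  then show ?thesis
    by simp
qed

lemma singular_value_attained:
  assumes "s \<in> singular_values M"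
  obtains z where "norm z = 1" "norm (M *v z) = s"
proof -
  obtain y where s: "s \<ge> 0" and y: "y \<noteq> 0" "(transpose M ** M) *v y = s\<^sup>2 *\<^sub>R y"
    using assms by (auto simp: singular_values_def)
  have "y \<bullet> ((transpose M ** M) *v y) = (norm (M *v y))\<^sup>2"
    unfolding matrix_vector_mul_assoc[symmetric] inner_transpose_mult power2_norm_eq_inner ..
  then have "(norm (M *v y))\<^sup>2 = (s * norm y)\<^sup>2"
    by (simp add: y(2) power2_norm_eq_inner power_mult_distrib)
  then have "norm (M *v y) = s * norm y"
    using s by (simp add: power2_eq_iff_nonneg)
  then show ?thesis
    using y(1) by (intro that[of "(1 / norm y) *\<^sub>R y"]) (auto simp: norm_matrix_vector_mult_scaleR)
qed

text \<open>Eigenvectors of the symmetric matrix \<open>transpose M ** M\<close> for different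
  eigenvalues are orthogonal, hence independent. Finiteness is what gives \<open>Min\<close> and
  \<open>Max\<close> their meaning in \<open>sigma_min\<close> and \<open>sigma_max\<close>.\<close>

lemma finite_singular_values: "finite (singular_values M)"
proof -
  define f where "f s = (SOME z. z \<noteq> 0 \<and> (transpose M ** M) *v z = s\<^sup>2 *\<^sub>R z)" for s :: real
  have f: "f s \<noteq> 0 \<and> (transpose M ** M) *v f s = s\<^sup>2 *\<^sub>R f s" if "s \<in> singular_values M" for s
    unfolding f_def by (rule someI_ex) (use that in \<open>auto simp: singular_values_def\<close>)
  have orth: "f s \<bullet> f t = 0" if st: "s \<in> singular_values M" "t \<in> singular_values M" "s \<noteq> t" for s t
  proof -
    have "f s \<bullet> ((transpose M ** M) *v f t) = f t \<bullet> ((transpose M ** M) *v f s)"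
      unfolding matrix_vector_mul_assoc[symmetric] inner_transpose_mult by (rule inner_commute)
    then have "t\<^sup>2 * (f s \<bullet> f t) = s\<^sup>2 * (f s \<bullet> f t)"
      using st f by (simp add: inner_commute)
    moreover have "s\<^sup>2 \<noteq> t\<^sup>2"
      using st by (auto simp: singular_values_def power2_eq_iff_nonneg)
    ultimately show ?thesis
      by auto
  qed
  have inj: "inj_on f (singular_values M)"
    using orth f by (metis inj_onI inner_eq_zero_iff)
  have "pairwise orthogonal (f ` singular_values M)"
    by (auto simp: pairwise_def orthogonal_def intro!: orth)
  moreover have "0 \<notin> f ` singular_values M"
    using f by force
  ultimately have "finite (f ` singular_values M)"
    by (simp add: pairwise_orthogonal_independent finiteI_independent)
  then show ?thesis
    using inj by (rule finite_imageD)
qed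

text \<open>The factor \<open>c\<close> is a sign: \<open>1\<close> serves the minimum over the unit
  sphere and \<open>-1\<close> the maximum.\<close>

lemma homogeneous_bound:
  fixes M :: "real^'n^'m"
  assumes "\<And>y. norm y = 1 \<Longrightarrow> c * (norm (M *v y))\<^sup>2 \<ge> c * m\<^sup>2"
  shows "c * ((norm (M *v y))\<^sup>2 - m\<^sup>2 * (norm y)\<^sup>2) \<ge> 0"
proof (cases "y = 0")
  case False
  have "c * m\<^sup>2 \<le> c * (norm (M *v ((1 / norm y) *\<^sub>R y)))\<^sup>2"
    using False by (intro assms) auto
  then show ?thesis
    using False unfolding norm_matrix_vector_mult_scaleR
    by (simp add: power_mult_distrib field_simps)
qed auto

lemma extremal_singular_value:
  assumes "norm z = 1" "c \<noteq> 0"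
    and "\<And>y. norm y = 1 \<Longrightarrow> c * (norm (M *v y))\<^sup>2 \<ge> c * (norm (M *v z))\<^sup>2"
  shows "norm (M *v z) \<in> singular_values M"
  using extremal_imp_eigenvector[OF homogeneous_bound[OF assms(3)] \<open>c \<noteq> 0\<close>, of z] assms(1)
  by (auto simp: singular_values_def intro!: exI[of _ z])

lemma sphere_nonempty: "sphere (0 :: real^'n) 1 \<noteq> {}"
  by (simp add: sphere_eq_empty)

lemma continuous_on_norm_mult: "continuous_on A (\<lambda>y. norm (M *v y))" for M :: "real^'n^'m"
  by (intro continuous_on_norm linear_continuous_on matrix_vector_mul_bounded_linear)

text \<open>The norm of \<open>M *v y\<close> attains its minimum on the unit sphere by compactness;
  the minimum is a singular value because a minimizer is an eigenvector, and the least one because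
  every singular value is attained on the sphere.\<close>

lemma sigma_min:
  fixes M :: "real^'n^'n"
  shows sigma_min_attained: "\<exists>z. norm z = 1 \<and> norm (M *v z) = sigma_min M"
    and sigma_min_le: "sigma_min M * norm y \<le> norm (M *v y)"
proof -
  obtain z where z: "z \<in> sphere 0 1" and le: "\<forall>y\<in>sphere 0 1. norm (M *v z) \<le> norm (M *v y)"
    using continuous_attains_inf[of "sphere 0 1" "\<lambda>y. norm (M *v y)"] sphere_nonempty
    by (auto simp: continuous_on_norm_mult)
  have sv: "norm (M *v z) \<in> singular_values M"
    using z le by (intro extremal_singular_value[of z 1]) (auto intro: power_mono)
  have least: "norm (M *v z) \<le> s" if "s \<in> singular_values M" for s
    using singular_value_attained[OF that] le by force
  have eq: "sigma_min M = norm (M *v z)"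
    unfolding sigma_min_def using sv least by (intro Min_eqI finite_singular_values)
  show "\<exists>z. norm z = 1 \<and> norm (M *v z) = sigma_min M"
    using z eq by (intro exI[of _ z]) auto
  have "0 \<le> 1 * ((norm (M *v y))\<^sup>2 - (sigma_min M)\<^sup>2 * (norm y)\<^sup>2)"
    using le by (intro homogeneous_bound) (auto simp: eq intro: power_mono)
  then have "(sigma_min M * norm y)\<^sup>2 \<le> (norm (M *v y))\<^sup>2"
    by (simp add: power_mult_distrib)
  then show "sigma_min M * norm y \<le> norm (M *v y)"
    by (rule power2_le_imp_le) simp
qed

lemma sigma_max:
  fixes M :: "real^'n^'n"
  shows sigma_max_attained: "\<exists>z. norm z = 1 \<and> norm (M *v z) = sigma_max M"
    and sigma_max_ge: "norm (M *v y) \<le> sigma_max M * norm y"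
proof -
  obtain z where z: "z \<in> sphere 0 1" and le: "\<forall>y\<in>sphere 0 1. norm (M *v y) \<le> norm (M *v z)"
    using continuous_attains_sup[of "sphere 0 1" "\<lambda>y. norm (M *v y)"] sphere_nonempty
    by (auto simp: continuous_on_norm_mult)
  have sv: "norm (M *v z) \<in> singular_values M"
    using z le by (intro extremal_singular_value[of z "-1"]) (auto intro: power_mono)
  have greatest: "s \<le> norm (M *v z)" if "s \<in> singular_values M" for s
    using singular_value_attained[OF that] le by force
  have eq: "sigma_max M = norm (M *v z)"
    unfolding sigma_max_def using sv greatest by (intro Max_eqI finite_singular_values)
  show "\<exists>z. norm z = 1 \<and> norm (M *v z) = sigma_max M"
    using z eq by (intro exI[of _ z]) auto
  have "0 \<le> -1 * ((norm (M *v y))\<^sup>2 - (sigma_max M)\<^sup>2 * (norm y)\<^sup>2)"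
    using le by (intro homogeneous_bound) (auto simp: eq intro: power_mono)
  then have "(norm (M *v y))\<^sup>2 \<le> (sigma_max M * norm y)\<^sup>2"
    by (simp add: power_mult_distrib)
  then show "norm (M *v y) \<le> sigma_max M * norm y"
    by (rule power2_le_imp_le) (simp add: eq)
qed

section \<open>The strict S-lemma\<close>

text \<open>Described through its restrictions to planes instead of a matrix: the S-lemma below
  works in planes only, and the forms it is applied to live on a product space.\<close>

definition quadratic_form :: "('a::euclidean_space \<Rightarrow> real) \<Rightarrow> bool" where
  "quadratic_form q \<longleftrightarrow> continuous_on UNIV q \<and>
     (\<forall>y z. \<exists>b. \<forall>s t. q (s *\<^sub>R y + t *\<^sub>R z) = s\<^sup>2 * q y + 2 * s * t * b + t\<^sup>2 * q z)"

lemma quadratic_form_inner: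
  fixes f g :: "'a::euclidean_space \<Rightarrow> 'b::euclidean_space"
  assumes "linear f" "linear g"
  shows "quadratic_form (\<lambda>z. f z \<bullet> g z)"
  unfolding quadratic_form_def
proof (intro conjI allI)
  show "continuous_on UNIV (\<lambda>z. f z \<bullet> g z)"
    using assms by (intro continuous_intros linear_continuous_on) (simp_all add: linear_conv_bounded_linear)
  fix y z
  show "\<exists>b. \<forall>s t. f (s *\<^sub>R y + t *\<^sub>R z) \<bullet> g (s *\<^sub>R y + t *\<^sub>R z) =
      s\<^sup>2 * (f y \<bullet> g y) + 2 * s * t * b + t\<^sup>2 * (f z \<bullet> g z)"
    by (rule exI[of _ "(f y \<bullet> g z + f z \<bullet> g y) / 2"])
       (simp add: linear_add[OF assms(1)] linear_add[OF assms(2)] linear_cmul[OF assms(1)]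
          linear_cmul[OF assms(2)] inner_add_left inner_add_right power2_eq_square field_simps)
qed

lemma quadratic_form_norm:
  fixes f :: "'a::euclidean_space \<Rightarrow> 'b::euclidean_space"
  shows "linear f \<Longrightarrow> quadratic_form (\<lambda>z. (norm (f z))\<^sup>2)"
  by (simp add: power2_norm_eq_inner quadratic_form_inner)

lemma quadratic_form_add:
  assumes "quadratic_form q" "quadratic_form r"
  shows "quadratic_form (\<lambda>z. q z + r z)"
  unfolding quadratic_form_def
proof (intro conjI allI)
  show "continuous_on UNIV (\<lambda>z. q z + r z)"
    using assms by (auto simp: quadratic_form_def intro!: continuous_intros)
  fix y z
  obtain b c where "\<And>s t. q (s *\<^sub>R y + t *\<^sub>R z) = s\<^sup>2 * q y + 2 * s * t * b + t\<^sup>2 * q z"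
    "\<And>s t. r (s *\<^sub>R y + t *\<^sub>R z) = s\<^sup>2 * r y + 2 * s * t * c + t\<^sup>2 * r z"
    using assms unfolding quadratic_form_def by meson
  then show "\<exists>b. \<forall>s t. q (s *\<^sub>R y + t *\<^sub>R z) + r (s *\<^sub>R y + t *\<^sub>R z) =
      s\<^sup>2 * (q y + r y) + 2 * s * t * b + t\<^sup>2 * (q z + r z)"
    by (intro exI[of _ "b + c"]) (simp add: algebra_simps)
qed

lemma quadratic_form_cmult:
  assumes "quadratic_form q"
  shows "quadratic_form (\<lambda>z. c * q z)"
  unfolding quadratic_form_def
proof (intro conjI allI)
  show "continuous_on UNIV (\<lambda>z. c * q z)"
    using assms by (auto simp: quadratic_form_def intro!: continuous_intros)
  fix y z
  obtain b where "\<And>s t. q (s *\<^sub>R y + t *\<^sub>R z) = s\<^sup>2 * q y + 2 * s * t * b + t\<^sup>2 * q z"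
    using assms unfolding quadratic_form_def by meson
  then show "\<exists>b. \<forall>s t. c * q (s *\<^sub>R y + t *\<^sub>R z) = s\<^sup>2 * (c * q y) + 2 * s * t * b + t\<^sup>2 * (c * q z)"
    by (intro exI[of _ "c * b"]) (simp add: algebra_simps)
qed

lemma quadratic_form_diff:
  "quadratic_form q \<Longrightarrow> quadratic_form r \<Longrightarrow> quadratic_form (\<lambda>z. q z - r z)"
  using quadratic_form_add[of q "\<lambda>z. -1 * r z"] quadratic_form_cmult[of r "-1"] by simp

lemma quadratic_form_scaleR: "quadratic_form q \<Longrightarrow> q (t *\<^sub>R z) = t\<^sup>2 * q z"
  unfolding quadratic_form_def
  by (metis add_0 mult_zero_left mult_zero_right power_zero_numeral scaleR_zero_left)

lemma quadratic_form_continuous_on: "quadratic_form q \<Longrightarrow> continuous_on S q"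
  unfolding quadratic_form_def using continuous_on_subset by blast

lemma quadratic_form_normalize:
  assumes "quadratic_form q" "z \<noteq> 0"
  shows "q z = (norm z)\<^sup>2 * q ((1 / norm z) *\<^sub>R z)"
  using quadratic_form_scaleR[OF assms(1), of "1 / norm z" z] assms(2) by (simp add: power_divide)

lemma quadratic_form_zero: "quadratic_form q \<Longrightarrow> q 0 = 0"
  using quadratic_form_scaleR[of q 0 0] by simp

text \<open>The indefinite form \<open>q1\<close> vanishes on two lines of the plane spanned by \<open>y\<close> and \<open>z\<close>; a
  positive combination of the values of \<open>q0\<close> on them has no mixed term.\<close>

lemma quadratic_forms_on_plane:
  assumes q0: "quadratic_form q0" and q1: "quadratic_form q1"
    and pos: "\<And>z. z \<noteq> 0 \<Longrightarrow> q1 z \<ge> 0 \<Longrightarrow> q0 z > 0"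
    and z: "q1 z < 0" and y: "q1 y > 0"
  shows "q0 y * q1 z < q0 z * q1 y"
proof -
  obtain b0 where b0: "\<And>s t. q0 (s *\<^sub>R y + t *\<^sub>R z) = s\<^sup>2 * q0 y + 2 * s * t * b0 + t\<^sup>2 * q0 z"
    using q0 unfolding quadratic_form_def by meson
  obtain b1 where b1: "\<And>s t. q1 (s *\<^sub>R y + t *\<^sub>R z) = s\<^sup>2 * q1 y + 2 * s * t * b1 + t\<^sup>2 * q1 z"
    using q1 unfolding quadratic_form_def by meson
  define \<alpha> where "\<alpha> = - q1 z"
  define \<beta> where "\<beta> = q1 y"
  define r where "r = sqrt (b1\<^sup>2 + \<alpha> * \<beta>)"
  have ab: "\<alpha> > 0" "\<beta> > 0"
    using z y by (auto simp: \<alpha>_def \<beta>_def)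
  have r2: "r\<^sup>2 = b1\<^sup>2 + \<alpha> * \<beta>"
    using ab by (simp add: r_def)
  have r: "\<bar>b1\<bar> < r"
    unfolding r_def using ab by (intro real_less_rsqrt) simp
  have root: "q0 (\<alpha> *\<^sub>R y + t *\<^sub>R z) > 0" if "t\<^sup>2 = \<alpha> * \<beta> + 2 * t * b1" for t
  proof (rule pos)
    have "q1 (\<alpha> *\<^sub>R y + t *\<^sub>R z) = \<alpha> * (\<alpha> * \<beta> + 2 * t * b1 - t\<^sup>2)"
      unfolding b1 by (simp add: \<alpha>_def \<beta>_def power2_eq_square algebra_simps)
    then show "q1 (\<alpha> *\<^sub>R y + t *\<^sub>R z) \<ge> 0"
      using that by simp
    show "\<alpha> *\<^sub>R y + t *\<^sub>R z \<noteq> 0"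
    proof
      assume "\<alpha> *\<^sub>R y + t *\<^sub>R z = 0"
      then have "\<alpha> *\<^sub>R y = (- t) *\<^sub>R z"
        by (simp add: eq_neg_iff_add_eq_0)
      then have "\<alpha>\<^sup>2 * q1 y = t\<^sup>2 * q1 z"
        using quadratic_form_scaleR[OF q1] by (metis power2_minus)
      moreover have "\<alpha>\<^sup>2 * q1 y > 0" "t\<^sup>2 * q1 z \<le> 0"
        using ab y z by (auto intro: mult_nonneg_nonpos)
      ultimately show False
        by simp
    qed
  qed
  define p where "p = b1 + r"
  define n where "n = r - b1"
  have pn: "p > 0" "n > 0" "p * n = \<alpha> * \<beta>"
    using r r2 by (auto simp: p_def n_def power2_eq_square algebra_simps)
  have "q0 (\<alpha> *\<^sub>R y + p *\<^sub>R z) > 0"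
    by (rule root) (use r2 in \<open>simp add: p_def power2_eq_square algebra_simps\<close>)
  moreover have "q0 (\<alpha> *\<^sub>R y + (- n) *\<^sub>R z) > 0"
    by (rule root) (use r2 in \<open>simp add: n_def power2_eq_square algebra_simps\<close>)
  ultimately have "0 < n * q0 (\<alpha> *\<^sub>R y + p *\<^sub>R z) + p * q0 (\<alpha> *\<^sub>R y + (- n) *\<^sub>R z)"
    using pn by (intro add_pos_pos mult_pos_pos)
  also have "\<dots> = (n + p) * (\<alpha>\<^sup>2 * q0 y + (p * n) * q0 z)"
    unfolding b0 by (simp add: power2_eq_square algebra_simps)
  also have "\<dots> = (n + p) * \<alpha> * (\<alpha> * q0 y + \<beta> * q0 z)"
    unfolding pn(3) by (simp add: power2_eq_square algebra_simps)
  finally have "\<alpha> * q0 y + \<beta> * q0 z > 0"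
    by (rule zero_less_mult_pos) (use pn ab in simp)
  then show ?thesis
    by (simp add: \<alpha>_def \<beta>_def mult.commute)
qed

text \<open>Where \<open>q0\<close> is nonpositive, \<open>q1\<close> is negative and
  \<open>\<tau>\<close> must be at least \<open>q0 z / q1 z\<close>; where \<open>q1\<close> is
  positive, \<open>\<tau>\<close> must be at most this ratio. The comparison on planes says that
  every lower bound is below every upper bound, so the supremum of the lower bounds works.\<close>

lemma S_lemma_nonneg:
  assumes q0: "quadratic_form q0" and q1: "quadratic_form q1"
    and pos: "\<And>z. z \<noteq> 0 \<Longrightarrow> q1 z \<ge> 0 \<Longrightarrow> q0 z > 0"
  obtains \<tau> where "\<tau> \<ge> 0" "\<And>z. q0 z - \<tau> * q1 z \<ge> 0"
proof -
  define C where "C = sphere 0 1 \<inter> {z. q0 z \<le> 0}"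
  define R where "R = (\<lambda>z. q0 z / q1 z) ` C"
  have neg: "q1 z < 0" if "z \<in> C" for z
    using that pos[of z] by (force simp: C_def)
  \<comment> \<open>On \<open>C\<close> the denominator \<open>q1\<close> is negative, so the ratio
    is continuous and, by compactness, bounded.\<close>
  have "compact C"
    unfolding C_def using quadratic_form_continuous_on[OF q0]
    by (intro compact_Int_closed closed_Collect_le) auto
  moreover have "continuous_on C (\<lambda>z. q0 z / q1 z)"
    using neg by (intro continuous_intros quadratic_form_continuous_on q0 q1) force
  ultimately have "compact R"
    unfolding R_def by (intro compact_continuous_image)
  then have bdd: "bdd_above (insert 0 R)"
    by (simp add: compact_imp_bounded bounded_imp_bdd_above)
  \<comment> \<open>The inserted \<open>0\<close> makes \<open>\<tau>\<close> nonnegative and covers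
    the case that \<open>C\<close> is empty.\<close>
  define \<tau> where "\<tau> = Sup (insert 0 R)"
  have unit: "q0 z - \<tau> * q1 z \<ge> 0" if z: "norm z = 1" for z
  proof -
    consider "q0 z \<le> 0" | "q0 z > 0" "q1 z \<le> 0" | "q1 z > 0"
      by linarith
    then show ?thesis
    proof cases
      case 1
      with z have C: "z \<in> C"
        by (simp add: C_def)
      then have "q0 z / q1 z \<le> \<tau>"
        unfolding \<tau>_def R_def by (intro cSup_upper bdd[unfolded R_def]) auto
      then show ?thesis
        using neg[OF C] by (simp add: field_simps)
    next
      case 2
      have "\<tau> \<ge> 0"
        unfolding \<tau>_def by (intro cSup_upper bdd) auto
      then show ?thesis
        using 2 by (smt (verit) mult_nonneg_nonpos)
    next
      case 3
      have "q0 z > 0"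
        using 3 z pos[of z] by force
      have "\<tau> \<le> q0 z / q1 z"
        unfolding \<tau>_def
      proof (rule cSup_least)
        fix x assume "x \<in> insert 0 R"
        then consider "x = 0" | y where "y \<in> C" "x = q0 y / q1 y"
          by (auto simp: R_def)
        then show "x \<le> q0 z / q1 z"
        proof cases
          case (2 y)
          show ?thesis
            unfolding 2(2) using quadratic_forms_on_plane[OF q0 q1 pos neg[OF 2(1)] 3]
              neg[OF 2(1)] 3
            by (simp add: neg_divide_le_eq pos_divide_le_eq)
        qed (use 3 \<open>q0 z > 0\<close> in auto)
      qed auto
      then show ?thesis
        using 3 by (simp add: field_simps)
    qed
  qed
  show ?thesis
  proof (rule that)
    show "\<tau> \<ge> 0"
      unfolding \<tau>_def by (intro cSup_upper bdd) auto
    have q: "quadratic_form (\<lambda>z. q0 z - \<tau> * q1 z)"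
      by (intro quadratic_form_diff quadratic_form_cmult q0 q1)
    show "q0 z - \<tau> * q1 z \<ge> 0" for z
      using quadratic_form_normalize[OF q, of z] unit[of "(1 / norm z) *\<^sub>R z"]
        quadratic_form_zero[OF q]
      by (cases "z = 0") auto
  qed
qed

text \<open>Subtracting a small multiple of the squared norm from \<open>q0\<close> preserves the
  hypothesis. The slack regained at the end gives strictness and also pays for raising the
  multiplier from nonnegative to positive.\<close>

lemma S_lemma_strict:
  assumes q0: "quadratic_form q0" and q1: "quadratic_form q1"
    and pos: "\<And>z. z \<noteq> 0 \<Longrightarrow> q1 z \<ge> 0 \<Longrightarrow> q0 z > 0"
  obtains \<tau> where "\<tau> > 0" "\<And>z. z \<noteq> 0 \<Longrightarrow> q0 z - \<tau> * q1 z > 0"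
proof -
  have sphere: "(1 / norm z) *\<^sub>R z \<in> sphere 0 1" if "z \<noteq> 0" for z :: 'a
    using that by simp
  obtain \<epsilon> where eps: "\<epsilon> > 0" "\<And>z. z \<in> sphere 0 1 \<Longrightarrow> q1 z \<ge> 0 \<Longrightarrow> q0 z > \<epsilon>"
  proof -
    define C where "C = sphere 0 1 \<inter> {z. 0 \<le> q1 z}"
    have C: "compact C"
      unfolding C_def using quadratic_form_continuous_on[OF q1]
      by (intro compact_Int_closed closed_Collect_le) auto
    show ?thesis
    proof (cases "C = {}")
      case True
      then show ?thesis
        by (intro that[of 1]) (auto simp: C_def)
    next
      case False
      obtain y where y: "y \<in> C" "\<And>z. z \<in> C \<Longrightarrow> q0 y \<le> q0 z"
        using continuous_attains_inf[OF C False quadratic_form_continuous_on[OF q0]] by blast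
      have "q0 y > 0"
        using y(1) pos[of y] by (force simp: C_def)
      with y(2) show ?thesis
        by (intro that[of "q0 y / 2"]) (force simp: C_def)+
    qed
  qed
  define qe where "qe z = q0 z - \<epsilon> * (norm z)\<^sup>2" for z
  have qe: "quadratic_form qe"
    unfolding qe_def by (intro quadratic_form_diff quadratic_form_cmult quadratic_form_norm q0 linear_id[unfolded id_def])
  have "qe z > 0" if "z \<noteq> 0" "q1 z \<ge> 0" for z
  proof -
    have "q1 ((1 / norm z) *\<^sub>R z) \<ge> 0"
      using that quadratic_form_normalize[OF q1, of z] by (simp add: zero_le_mult_iff)
    then have "qe ((1 / norm z) *\<^sub>R z) > 0"
      using eps(2)[OF sphere[OF that(1)]] that(1) by (simp add: qe_def)
    then show ?thesis
      using that(1) quadratic_form_normalize[OF qe, of z] by simp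
  qed
  then obtain \<tau> where tau: "\<tau> \<ge> 0" "\<And>z. qe z - \<tau> * q1 z \<ge> 0"
    using S_lemma_nonneg[OF qe q1] by metis
  have "bounded (q1 ` sphere 0 1)"
    by (intro compact_imp_bounded compact_continuous_image quadratic_form_continuous_on q1) auto
  then obtain N where N: "N > 0" "\<And>z. z \<in> sphere 0 1 \<Longrightarrow> \<bar>q1 z\<bar> \<le> N"
    unfolding bounded_pos by auto
  have N': "q1 z \<le> N * (norm z)\<^sup>2" if "z \<noteq> 0" for z
    using N(2)[OF sphere[OF that]] quadratic_form_normalize[OF q1 that] that
    by (simp add: mult.commute abs_le_iff)
  show ?thesis
  proof (rule that)
    \<comment> \<open>As \<open>N\<close> bounds \<open>q1\<close> on the unit sphere, the increase
      \<open>\<epsilon> / (2 * N)\<close> uses up at most half of the slack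
      \<open>\<epsilon> * (norm z)\<^sup>2\<close>.\<close>
    show "\<tau> + \<epsilon> / (2 * N) > 0"
      using tau(1) eps(1) N(1) by (simp add: add_nonneg_pos)
    fix z :: 'a assume z: "z \<noteq> 0"
    have "\<epsilon> / (2 * N) * q1 z \<le> \<epsilon> / (2 * N) * (N * (norm z)\<^sup>2)"
      using N'[OF z] eps(1) N(1) by (intro mult_left_mono) auto
    also have "\<dots> = \<epsilon> * (norm z)\<^sup>2 / 2"
      using N(1) by simp
    also have "\<dots> < \<epsilon> * (norm z)\<^sup>2"
      using eps(1) z by simp
    finally show "q0 z - (\<tau> + \<epsilon> / (2 * N)) * q1 z > 0"
      using tau(2)[of z] by (simp add: qe_def algebra_simps)
  qed
qed

section \<open>Input-to-state stability from a Lyapunov function\<close>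

lemma class_K_linear: "c > 0 \<Longrightarrow> class_K (\<lambda>s. c * s)"
  by (auto simp: class_K_def strict_mono_on_def intro!: continuous_intros)

lemma class_KL_exponential:
  assumes "c > 0" "0 < \<rho>" "\<rho> < 1"
  shows "class_KL (\<lambda>s r. c * sqrt (\<rho> powr r) * s)"
  unfolding class_KL_def
proof (intro conjI allI impI)
  show "continuous_on ({0..} \<times> {0..}) (\<lambda>(r, s). c * sqrt (\<rho> powr s) * r)"
    unfolding split_def using assms by (intro continuous_intros) auto
  show "class_K (\<lambda>r. c * sqrt (\<rho> powr s) * r)" for s
    using assms by (intro class_K_linear) auto
  fix r :: real assume r: "r \<ge> 0"
  show "antimono_on {0..} (\<lambda>s. c * sqrt (\<rho> powr s) * r)"
    using assms r by (intro monotone_onI mult_right_mono mult_left_mono real_sqrt_le_mono powr_mono') auto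
  have "((\<lambda>s. \<rho> powr s) \<longlongrightarrow> 0) at_top"
  proof -
    have "filterlim (\<lambda>s. ln \<rho> * s) at_bot at_top"
      using assms by (intro filterlim_tendsto_neg_mult_at_bot[OF tendsto_const] filterlim_ident) auto
    then have "((\<lambda>s. exp (ln \<rho> * s)) \<longlongrightarrow> 0) at_top"
      by (rule filterlim_compose[OF exp_at_bot])
    then show ?thesis
      using assms by (simp add: powr_def mult.commute)
  qed
  then have "((\<lambda>s. c * sqrt (\<rho> powr s) * r) \<longlongrightarrow> c * sqrt 0 * r) at_top"
    by (intro tendsto_intros)
  then show "((\<lambda>s. c * sqrt (\<rho> powr s) * r) \<longlongrightarrow> 0) at_top"
    by simp
qed

lemma norm_le_sup_before: "j < k \<Longrightarrow> norm (v j) \<le> sup_before v k"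
  by (auto simp: sup_before_def)

lemma sup_before_nonneg: "sup_before v k \<ge> 0"
proof (cases "k = 0")
  case False
  then have "norm (v 0) \<le> sup_before v k"
    by (intro norm_le_sup_before) simp
  then show ?thesis
    using norm_ge_zero order_trans by blast
qed (simp add: sup_before_def)

lemma le_sum_of_root_bounds:
  fixes x A B C D :: real
  assumes "x\<^sup>2 \<le> A\<^sup>2 + B\<^sup>2 + C\<^sup>2 + D\<^sup>2" "A \<ge> 0" "B \<ge> 0" "C \<ge> 0" "D \<ge> 0"
  shows "x \<le> A + B + C + D"
proof (rule power2_le_imp_le)
  have "0 \<le> A * B + A * C + A * D + B * C + B * D + C * D"
    using assms by simp
  then show "x\<^sup>2 \<le> (A + B + C + D)\<^sup>2"
    using assms(1) by (simp add: power2_eq_square algebra_simps)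
qed (use assms in simp)

text \<open>With \<open>a = \<kappa>\<psi> * \<sigma>\<^sup>2\<close>, the upper bound turns the
  decrease by \<open>(norm e)\<^sup>2\<close> into a contraction of \<open>V\<close> by
  \<open>\<rho> = 1 - 1 / a\<close>. The geometric series of the disturbances sums to
  \<open>1 / (1 - \<rho>) = a\<close>, which is how \<kappa>\<psi> and \<sigma> get into the
  gains.\<close>

lemma lyapunov_imp_iss_with:
  fixes S :: "('np::finite, 'nx::finite, 'nu::finite, 'ny::finite, 'nv::finite, 'nw::finite, 'nf::finite) lpv_system"
  assumes lyap: "iss_lyapunov S \<Lambda> L K V (\<kappa>\<psi> * \<sigma>\<^sup>2) \<kappa>v \<kappa>w \<kappa>\<psi>" and slope: "slope_restricted \<Lambda> \<phi>"
    and pos: "\<kappa>v > 0" "\<kappa>w > 0" "\<kappa>\<psi> > 0" "\<sigma> > 0" and a1: "\<kappa>\<psi> * \<sigma>\<^sup>2 > 1"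
  defines "\<rho> \<equiv> 1 - 1 / (\<kappa>\<psi> * \<sigma>\<^sup>2)"
  shows "iss_with S \<phi> L K
          (\<lambda>s r. sqrt \<kappa>\<psi> * \<sigma> * sqrt (\<rho> powr r) * s)
          (\<lambda>s. sqrt (\<kappa>\<psi> * \<kappa>v) * \<sigma> * s)
          (\<lambda>s. sqrt (\<kappa>\<psi> * \<kappa>w) * \<sigma> * s)
          (\<lambda>s. \<kappa>\<psi> * \<sigma> * s)"
  unfolding iss_with_def
proof (intro conjI allI impI)
  define a where "a = \<kappa>\<psi> * \<sigma>\<^sup>2"
  have a: "a > 1" and rho: "0 < \<rho>" "\<rho> < 1" "\<rho> * a = a - 1"
    using a1 by (auto simp: \<rho>_def a_def[symmetric] field_simps)
  show "class_KL (\<lambda>s r. sqrt \<kappa>\<psi> * \<sigma> * sqrt (\<rho> powr r) * s)"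
    using pos rho by (intro class_KL_exponential) auto
  show "class_K (\<lambda>s. sqrt (\<kappa>\<psi> * \<kappa>v) * \<sigma> * s)" "class_K (\<lambda>s. sqrt (\<kappa>\<psi> * \<kappa>w) * \<sigma> * s)"
    "class_K (\<lambda>s. \<kappa>\<psi> * \<sigma> * s)"
    using pos by (auto intro!: class_K_linear)
  fix ph :: "nat \<Rightarrow> real^'np" and x :: "nat \<Rightarrow> real^'nx" and v :: "nat \<Rightarrow> real^'nv"
    and w :: "nat \<Rightarrow> real^'nw" and \<psi> e :: "nat \<Rightarrow> real^'nx" and k
  assume h: "(\<forall>k. ph k \<in> pset S) \<and> bounded (range v) \<and> bounded (range w) \<and> bounded (range \<psi>) \<and>
    (\<forall>k. error_step S \<phi> L K (ph (Suc k)) (ph k) (x k) (v k) (w k) (\<psi> k) (e k) (e (Suc k)))"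
  have ph: "ph j \<in> pset S" for j
    using h by blast
  have lower: "(norm (e j))\<^sup>2 \<le> V (e j) (ph j)" and upper: "V (e j) (ph j) \<le> a * (norm (e j))\<^sup>2" for j
    using lyap ph by (auto simp: iss_lyapunov_def a_def)
  have decrease: "V (e (Suc j)) (ph (Suc j)) - V (e j) (ph j) \<le>
      - (norm (e j))\<^sup>2 + \<kappa>v * (norm (v j))\<^sup>2 + \<kappa>w * (norm (w j))\<^sup>2 + \<kappa>\<psi> * (norm (\<psi> j))\<^sup>2" for j
    using lyap slope ph h unfolding iss_lyapunov_def by meson
  \<comment> \<open>A bound on the disturbance terms at all times before the fixed \<open>k\<close>,
    so the induction below runs only up to \<open>k\<close>. The value \<open>a * M\<close> is the
    fixed point of the recursion that adds \<open>M\<close> after scaling by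
    \<open>\<rho>\<close>.\<close>
  define M where "M = \<kappa>v * (sup_before v k)\<^sup>2 + \<kappa>w * (sup_before w k)\<^sup>2 + \<kappa>\<psi> * (sup_before \<psi> k)\<^sup>2"
  have "V (e j) (ph j) \<le> \<rho> ^ j * a * (norm (e 0))\<^sup>2 + a * M" if "j \<le> k" for j
    using that
  proof (induction j)
    case 0
    have "M \<ge> 0"
      using pos by (simp add: M_def)
    then show ?case
      using upper[of 0] a by (simp add: add_increasing2)
  next
    case (Suc j)
    have "\<kappa>v * (norm (v j))\<^sup>2 + \<kappa>w * (norm (w j))\<^sup>2 + \<kappa>\<psi> * (norm (\<psi> j))\<^sup>2 \<le> M"
      unfolding M_def using pos Suc.prems
      by (intro add_mono mult_left_mono power_mono norm_le_sup_before) auto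
    moreover have "(1 - \<rho>) * V (e j) (ph j) \<le> (norm (e j))\<^sup>2"
      using upper[of j] a by (simp add: \<rho>_def a_def[symmetric] field_simps)
    ultimately have "V (e (Suc j)) (ph (Suc j)) \<le> \<rho> * V (e j) (ph j) + M"
      using decrease[of j] by (simp add: algebra_simps)
    also have "\<dots> \<le> \<rho> * (\<rho> ^ j * a * (norm (e 0))\<^sup>2 + a * M) + M"
      using Suc rho by (intro add_right_mono mult_left_mono) auto
    also have "\<dots> = \<rho> ^ Suc j * a * (norm (e 0))\<^sup>2 + (\<rho> * a) * M + M"
      by (simp add: algebra_simps)
    also have "\<dots> = \<rho> ^ Suc j * a * (norm (e 0))\<^sup>2 + a * M"
      unfolding rho(3) by (simp add: algebra_simps)
    finally show ?case .
  qed
  from this[of k] lower[of k]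
  have "(norm (e k))\<^sup>2 \<le> \<rho> ^ k * a * (norm (e 0))\<^sup>2 + a * M"
    by simp
  also have "\<dots> = (sqrt \<kappa>\<psi> * \<sigma> * sqrt (\<rho> powr real k) * norm (e 0))\<^sup>2
      + (sqrt (\<kappa>\<psi> * \<kappa>v) * \<sigma> * sup_before v k)\<^sup>2
      + (sqrt (\<kappa>\<psi> * \<kappa>w) * \<sigma> * sup_before w k)\<^sup>2
      + (\<kappa>\<psi> * \<sigma> * sup_before \<psi> k)\<^sup>2"
    using pos rho by (simp add: power_mult_distrib powr_realpow a_def M_def)
      (simp add: power2_eq_square algebra_simps)
  finally show "norm (e k) \<le> sqrt \<kappa>\<psi> * \<sigma> * sqrt (\<rho> powr real k) * norm (e 0)
      + sqrt (\<kappa>\<psi> * \<kappa>v) * \<sigma> * sup_before v k + sqrt (\<kappa>\<psi> * \<kappa>w) * \<sigma> * sup_before w k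
      + \<kappa>\<psi> * \<sigma> * sup_before \<psi> k"
    by (rule le_sum_of_root_bounds) (use pos rho sup_before_nonneg in \<open>auto intro!: mult_nonneg_nonneg\<close>)
qed

lemma lyapunov_imp_iss_guarantee:
  fixes S :: "('np::finite, 'nx::finite, 'nu::finite, 'ny::finite, 'nv::finite, 'nw::finite, 'nf::finite) lpv_system"
  assumes "iss_lyapunov S \<Lambda> L K (poly_quadratic \<xi> P) (\<kappa>\<psi> * \<sigma>\<^sup>2) \<kappa>v \<kappa>w \<kappa>\<psi>" "slope_restricted \<Lambda> \<phi>"
    and "\<kappa>v > 0" "\<kappa>w > 0" "\<kappa>\<psi> > 0" "\<sigma> > 0" "\<kappa>\<psi> * \<sigma>\<^sup>2 > 1"
  shows "iss_guarantee S \<phi> \<Lambda> \<xi> L K P \<kappa>v \<kappa>w \<kappa>\<psi> \<sigma>"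
  unfolding iss_guarantee_def
proof (intro conjI exI[of _ "1 - 1 / (\<kappa>\<psi> * \<sigma>\<^sup>2)"])
  show "0 < 1 - 1 / (\<kappa>\<psi> * \<sigma>\<^sup>2)" "1 - 1 / (\<kappa>\<psi> * \<sigma>\<^sup>2) < 1"
    using assms(7) by (auto simp: field_simps)
qed (use assms in \<open>auto intro: lyapunov_imp_iss_with\<close>)

section \<open>Consequences of the matrix inequality\<close>

text \<open>The five averaged arguments enter the form affinely and are never multiplied with one
  another; terms free of them carry the total weight one.\<close>

lemma lmi_form_convex_sum:
  fixes c :: "'j \<Rightarrow> real"
  assumes "(\<Sum>j\<in>J. c j) = 1"
  shows "lmi_form Ebar A G F H C D \<Lambda> P (\<Sum>j\<in>J. c j *\<^sub>R P' j) (\<Sum>j\<in>J. c j *\<^sub>R X j)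
      (\<Sum>j\<in>J. c j *\<^sub>R Y j) (\<Sum>j\<in>J. c j *\<^sub>R Z j) (\<Sum>j\<in>J. c j * \<tau> j) \<kappa>v \<kappa>w \<kappa>\<psi> z e s v w q =
    (\<Sum>j\<in>J. c j * lmi_form Ebar A G F H C D \<Lambda> P (P' j) (X j) (Y j) (Z j) (\<tau> j) \<kappa>v \<kappa>w \<kappa>\<psi> z e s v w q)"
proof -
  have const: "(\<Sum>j\<in>J. c j * r) = r" for r
    using assms by (simp add: sum_distrib_right[symmetric])
  have mat: "(\<Sum>j\<in>J. c j *\<^sub>R M j) *v y = (\<Sum>j\<in>J. c j *\<^sub>R (M j *v y))"
    for M :: "'j \<Rightarrow> real^'p^'q" and y
    by (simp add: sum_matrix_vector_mult scaleR_matrix_vector_assoc)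
  have vec: "M *v (\<Sum>j\<in>J. c j *\<^sub>R y j) = (\<Sum>j\<in>J. c j *\<^sub>R (M *v y j))"
    for M :: "real^'p^'q" and y
    by (simp add: linear_sum[OF matrix_vector_mul_linear] matrix_vector_mult_scaleR)
  have inn: "y \<bullet> (\<Sum>j\<in>J. c j *\<^sub>R u j) = (\<Sum>j\<in>J. c j * (y \<bullet> u j))" for y :: "real^'p" and u
    by (simp add: inner_sum_right)
  have scale: "(\<Sum>j\<in>J. c j * \<tau> j) *\<^sub>R y = (\<Sum>j\<in>J. c j *\<^sub>R (\<tau> j *\<^sub>R y))" for y :: "real^'p"
    by (simp add: scaleR_sum_left)
  show ?thesis
    unfolding lmi_form_def mat inner_add_right inner_diff_right matrix_vector_right_distrib
      matrix_vector_mult_diff_distrib vec inn scale distrib_left right_diff_distrib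
      sum.distrib sum_subtractf const
    by (simp add: sum_distrib_left sum_distrib_right mult_ac)
qed

lemma lmi_pos_convex_sum:
  fixes c :: "'j::finite \<Rightarrow> real" and Ebar :: "real^'nx^'nx" and G :: "real^'nf^'nx"
    and F :: "real^'nv^'nx" and D :: "real^'nw^'ny"
  assumes c: "\<And>j. c j \<ge> 0" "(\<Sum>j\<in>UNIV. c j) = 1"
    and pos: "\<And>j. lmi_pos Ebar A G F H C D \<Lambda> P (P' j) (X j) (Y j) (Z j) (\<tau> j) \<kappa>v \<kappa>w \<kappa>\<psi>"
  shows "lmi_pos Ebar A G F H C D \<Lambda> P (\<Sum>j\<in>UNIV. c j *\<^sub>R P' j) (\<Sum>j\<in>UNIV. c j *\<^sub>R X j)
      (\<Sum>j\<in>UNIV. c j *\<^sub>R Y j) (\<Sum>j\<in>UNIV. c j *\<^sub>R Z j) (\<Sum>j\<in>UNIV. c j * \<tau> j) \<kappa>v \<kappa>w \<kappa>\<psi>"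
  unfolding lmi_pos_def lmi_form_convex_sum[OF c(2)]
proof (intro allI impI)
  fix z e q :: "real^'nx" and s :: "real^'nf" and v :: "real^'nv" and w :: "real^'nw"
  assume "(z, e, s, v, w, q) \<noteq> (0, 0, 0, 0, 0, 0)"
  with pos have f: "lmi_form Ebar A G F H C D \<Lambda> P (P' j) (X j) (Y j) (Z j) (\<tau> j) \<kappa>v \<kappa>w \<kappa>\<psi> z e s v w q > 0" for j
    unfolding lmi_pos_def by blast
  obtain j where "c j > 0"
    using c by (metis less_le sum.neutral zero_neq_one)
  with f c show "(\<Sum>j\<in>UNIV. c j * lmi_form Ebar A G F H C D \<Lambda> P (P' j) (X j) (Y j) (Z j) (\<tau> j) \<kappa>v \<kappa>w \<kappa>\<psi> z e s v w q) > 0"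
    by (intro sum_pos2[of _ j]) (auto intro!: mult_nonneg_nonneg less_imp_le[OF f])
qed

text \<open>The product \<open>X ** M\<close> has trivial kernel, and a right inverse of the product
  yields one of \<open>X\<close>.\<close>

lemma invertible_if_inner_pos:
  fixes X M :: "real^'n^'n"
  assumes "\<And>z. z \<noteq> 0 \<Longrightarrow> z \<bullet> (X *v (M *v z)) > 0"
  shows "invertible X"
proof -
  have "invertible (X ** M)"
    unfolding invertible_left_inverse matrix_left_invertible_ker
    using assms by (metis inner_zero_right less_irrefl matrix_vector_mul_assoc)
  then obtain B where "(X ** M) ** B = mat 1"
    unfolding invertible_right_inverse by blast
  then show ?thesis
    unfolding invertible_right_inverse by (metis matrix_mul_assoc)
qed

context
  fixes Ebar A P P' X :: "real^'nx^'nx" and G :: "real^'nf^'nx" and F :: "real^'nv^'nx"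
    and H :: "real^'nx^'nf" and C :: "real^'nx^'ny" and D :: "real^'nw^'ny" and \<Lambda> :: "real^'nf^'nf"
    and Y :: "real^'ny^'nx" and Z :: "real^'ny^'nf" and \<tau> \<kappa>v \<kappa>w \<kappa>\<psi> :: real
  assumes lmi: "lmi_pos Ebar A G F H C D \<Lambda> P P' X Y Z \<tau> \<kappa>v \<kappa>w \<kappa>\<psi>"
begin

lemma lmi_form_nonneg: "lmi_form Ebar A G F H C D \<Lambda> P P' X Y Z \<tau> \<kappa>v \<kappa>w \<kappa>\<psi> z e s v w q \<ge> 0"
proof (cases "(z, e, s, v, w, q) = (0, 0, 0, 0, 0, 0)")
  case True
  then show ?thesis
    by (simp add: lmi_form_def)
next
  case False
  with lmi show ?thesis
    unfolding lmi_pos_def by (meson less_imp_le)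
qed

lemma lmi_pos_lower:
  assumes "e \<noteq> 0"
  shows "(norm e)\<^sup>2 < e \<bullet> (P *v e)"
proof -
  have "lmi_form Ebar A G F H C D \<Lambda> P P' X Y Z \<tau> \<kappa>v \<kappa>w \<kappa>\<psi> 0 e 0 0 0 0 > 0"
    using lmi assms unfolding lmi_pos_def by blast
  then show ?thesis
    by (simp add: lmi_form_def)
qed

text \<open>The last block is chosen as \<open>- (Ebar *v e)\<close> so that the two terms
  containing \<open>X\<close> cancel.\<close>

lemma lmi_pos_upper:
  assumes "e \<noteq> 0"
  shows "e \<bullet> (P' *v e) < \<kappa>\<psi> * (norm (Ebar *v e))\<^sup>2"
proof -
  have "lmi_form Ebar A G F H C D \<Lambda> P P' X Y Z \<tau> \<kappa>v \<kappa>w \<kappa>\<psi> e 0 0 0 0 (- (Ebar *v e)) > 0"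
    using lmi assms unfolding lmi_pos_def by blast
  then show ?thesis
    by (simp add: lmi_form_def linear_neg[OF matrix_vector_mul_linear] inner_minus_right)
qed

lemma lmi_pos_invertible:
  assumes psd: "\<And>z. z \<bullet> (P' *v z) \<ge> 0"
  shows "invertible X"
proof (rule invertible_if_inner_pos)
  fix z :: "real^'nx" assume "z \<noteq> 0"
  then have "lmi_form Ebar A G F H C D \<Lambda> P P' X Y Z \<tau> \<kappa>v \<kappa>w \<kappa>\<psi> z 0 0 0 0 0 > 0"
    using lmi unfolding lmi_pos_def by blast
  then show "z \<bullet> (X *v (Ebar *v z)) > 0"
    using psd[of z] by (simp add: lmi_form_def)
qed

text \<open>In the sector terms \<open>\<tau>\<close> and \<open>Z\<close> stay separate: the
  quotient defining the gain \<open>K\<close> is formed only after averaging over both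
  vertices.\<close>

lemma lmi_pos_decrease:
  assumes Y: "Y = X ** L"
    and z: "Ebar *v z = A *v e - L *v (C *v e) + G *v s - F *v v + L *v (D *v w) + q"
  shows "z \<bullet> (P' *v z) \<le> e \<bullet> (P *v e) - (norm e)\<^sup>2
      + \<kappa>v * (norm v)\<^sup>2 + \<kappa>w * (norm w)\<^sup>2 + \<kappa>\<psi> * (norm q)\<^sup>2
      + 2 * \<tau> * (norm s)\<^sup>2 - 2 * (s \<bullet> (\<Lambda> *v (\<tau> *\<^sub>R (H *v e) - Z *v (C *v e) + Z *v (D *v w))))"
proof -
  have neg: "M *v (- y) = - (M *v y)" for M :: "real^'p^'q" and y
    by (simp add: linear_neg[OF matrix_vector_mul_linear])
  have Yv: "Y *v y = X *v (L *v y)" for y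
    by (simp add: Y matrix_vector_mul_assoc)
  have "0 \<le> lmi_form Ebar A G F H C D \<Lambda> P P' X Y Z \<tau> \<kappa>v \<kappa>w \<kappa>\<psi> z (- e) s (- v) (- w) (- q)"
    by (rule lmi_form_nonneg)
  then show ?thesis
    unfolding lmi_form_def neg z Yv matrix_vector_right_distrib matrix_vector_mult_diff_distrib
    by (simp add: inner_add_right inner_diff_right neg)
qed

end

lemma convex_quadratic_sum:
  fixes c :: "'i::finite \<Rightarrow> real" and z :: "'i \<Rightarrow> real^'n"
  assumes c: "\<And>i. c i \<ge> 0" "(\<Sum>i\<in>UNIV. c i) = 1" and sym: "sym_mat M"
    and psd: "\<And>y. y \<bullet> (M *v y) \<ge> 0"
  shows "(\<Sum>i\<in>UNIV. c i *\<^sub>R z i) \<bullet> (M *v (\<Sum>i\<in>UNIV. c i *\<^sub>R z i)) \<le> (\<Sum>i\<in>UNIV. c i * (z i \<bullet> (M *v z i)))"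
proof -
  define m where "m = (\<Sum>i\<in>UNIV. c i *\<^sub>R z i)"
  have lin: "(\<Sum>i\<in>UNIV. c i * (u \<bullet> z i)) = u \<bullet> m" for u
    by (simp add: m_def inner_sum_right)
  have swap: "m \<bullet> (M *v z i) = (M *v m) \<bullet> z i" "z i \<bullet> (M *v m) = (M *v m) \<bullet> z i" for i
    using symmetric_inner[OF sym, of m "z i"] by (simp_all add: inner_commute)
  \<comment> \<open>Jensen's inequality as nonnegativity of a variance: the mean of the form at the
    deviations from \<open>m\<close> is the gap between the two sides.\<close>
  have "0 \<le> (\<Sum>i\<in>UNIV. c i * ((z i - m) \<bullet> (M *v (z i - m))))"
    using c psd by (intro sum_nonneg mult_nonneg_nonneg) auto
  also have "\<dots> = (\<Sum>i\<in>UNIV. c i * (z i \<bullet> (M *v z i)) - 2 * (c i * ((M *v m) \<bullet> z i)) + c i * (m \<bullet> (M *v m)))"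
    by (intro sum.cong refl)
       (simp add: matrix_vector_mult_diff_distrib inner_diff_left inner_diff_right swap algebra_simps)
  also have "\<dots> = (\<Sum>i\<in>UNIV. c i * (z i \<bullet> (M *v z i))) - 2 * ((M *v m) \<bullet> m) + m \<bullet> (M *v m)"
    using c(2) by (simp add: sum.distrib sum_subtractf sum_distrib_left[symmetric] lin
        sum_distrib_right[symmetric])
  finally show ?thesis
    by (simp add: m_def[symmetric] inner_commute)
qed

section \<open>From the matrix inequalities to the observer\<close>

lemma lmi_solution_iff_lmi_pos:
  "lmi_solution S \<Lambda> Ebar Ai Gi Fi P X Y Z \<tau> \<kappa>v \<kappa>w \<kappa>\<psi> \<longleftrightarrow>
     (\<forall>i. sym_mat (P i)) \<and> (\<forall>i j. \<tau> i j > 0) \<and> \<kappa>v > 0 \<and> \<kappa>w > 0 \<and> \<kappa>\<psi> > 0 \<and>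
     (\<forall>i j. lmi_pos Ebar (Ai i) (Gi i) (Fi i) (sH S) (sC S) (sD S) \<Lambda>
              (P i) (P j) (X i j) (Y i j) (Z i j) (\<tau> i j) \<kappa>v \<kappa>w \<kappa>\<psi>)"
  unfolding lmi_solution_def pos_def_lmi_matrix_iff by (auto intro: sym_mat_diff sym_mat_He)

lemma lmi_solution_mono:
  assumes "lmi_solution S \<Lambda> Ebar Ai Gi Fi P X Y Z \<tau> \<kappa>v \<kappa>w \<kappa>\<psi>" "\<kappa>\<psi> \<le> \<kappa>"
  shows "lmi_solution S \<Lambda> Ebar Ai Gi Fi P X Y Z \<tau> \<kappa>v \<kappa>w \<kappa>"
proof -
  have "lmi_form Ebar A G F H C D \<Lambda> P P' X Y Z \<tau> \<kappa>v \<kappa>w \<kappa>\<psi> z e s v w q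
      \<le> lmi_form Ebar A G F H C D \<Lambda> P P' X Y Z \<tau> \<kappa>v \<kappa>w \<kappa> z e s v w q"
    for A G F H C D P P' X Y Z \<tau> z e s v w q
    using assms(2) by (simp add: lmi_form_def mult_right_mono)
  then have "lmi_pos Ebar A G F H C D \<Lambda> P P' X Y Z \<tau> \<kappa>v \<kappa>w \<kappa>"
    if "lmi_pos Ebar A G F H C D \<Lambda> P P' X Y Z \<tau> \<kappa>v \<kappa>w \<kappa>\<psi>" for A G F H C D P P' X Y Z \<tau>
    using that unfolding lmi_pos_def by (meson less_le_trans)
  then show ?thesis
    using assms unfolding lmi_solution_iff_lmi_pos by (smt (verit))
qed

lemma poly_quadratic_eq: "poly_quadratic \<xi> P e p = (\<Sum>i\<in>UNIV. \<xi> i p * (e \<bullet> (P i *v e)))"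
  by (simp add: poly_quadratic_def scaleR_matrix_vector_assoc[symmetric])

lemma poly_quadratic_matrix: "poly_quadratic \<xi> P e p = e \<bullet> ((\<Sum>i\<in>UNIV. \<xi> i p *\<^sub>R P i) *v e)"
  by (simp add: poly_quadratic_def sum_matrix_vector_mult inner_sum_right)

lemma matrix_inv_mult:
  fixes M :: "real^'n^'n"
  assumes "invertible M"
  shows "matrix_inv M ** M = mat 1" "M ** matrix_inv M = mat 1"
proof -
  have "M ** matrix_inv M = mat 1 \<and> matrix_inv M ** M = mat 1"
    using assms unfolding invertible_def matrix_inv_def by (rule someI_ex)
  then show "matrix_inv M ** M = mat 1" "M ** matrix_inv M = mat 1"
    by auto
qed

text \<open>The slope restriction is applied between \<open>h + sH S *v x\<close> and
  \<open>sH S *v x\<close>, so the unknown state drops out of the difference of the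
  arguments.\<close>

lemma phi_tilde_sector:
  fixes K :: "real^'np \<Rightarrow> real^'np \<Rightarrow> real^'ny^'nf"
    and S :: "('np::finite, 'nx::finite, 'nu::finite, 'ny::finite, 'nv::finite, 'nw::finite, 'nf::finite) lpv_system"
  assumes "slope_restricted \<Lambda> \<phi>" and s: "s = phi_tilde S \<phi> K pp p e x w"
  shows "(norm s)\<^sup>2 \<le> s \<bullet> (\<Lambda> *v ((sH S - K pp p ** sC S) *v e + (K pp p ** sD S) *v w))"
proof -
  define h where "h = (sH S - K pp p ** sC S) *v e + (K pp p ** sD S) *v w"
  have "2 * (norm (\<phi> (h + sH S *v x) - \<phi> (sH S *v x)))\<^sup>2
      - 2 * ((\<phi> (h + sH S *v x) - \<phi> (sH S *v x)) \<bullet> (\<Lambda> *v (h + sH S *v x - sH S *v x))) \<le> 0"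
    using assms(1) unfolding slope_restricted_def by blast
  then show ?thesis
    by (simp add: s phi_tilde_def h_def)
qed

section \<open>Polytopic systems with a constant descriptor matrix\<close>

locale constant_descriptor_system =
  fixes S :: "('np::finite, 'nx::finite, 'nu::finite, 'ny::finite, 'nv::finite, 'nw::finite, 'nf::finite) lpv_system"
    and \<xi> :: "'i::finite \<Rightarrow> real^'np \<Rightarrow> real"
    and Ei Ai :: "'i \<Rightarrow> real^'nx^'nx" and Bi :: "'i \<Rightarrow> real^'nu^'nx"
    and Fi :: "'i \<Rightarrow> real^'nv^'nx" and Gi :: "'i \<Rightarrow> real^'nf^'nx"
    and Ebar :: "real^'nx^'nx" and \<Lambda> :: "real^'nf^'nf"
  assumes polytopic: "polytopic S \<xi> Ei Ai Bi Fi Gi"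
    and invertible_Ebar: "invertible Ebar"
    and descriptor: "p \<in> pset S \<Longrightarrow> sE S p = Ebar"
begin

lemma weights: "p \<in> pset S \<Longrightarrow> \<xi> i p \<ge> 0" "p \<in> pset S \<Longrightarrow> (\<Sum>i\<in>UNIV. \<xi> i p) = 1"
  using polytopic by (auto simp: polytopic_def)

lemma system_matrices:
  assumes "p \<in> pset S"
  shows "sA S p = (\<Sum>i\<in>UNIV. \<xi> i p *\<^sub>R Ai i)" "sF S p = (\<Sum>i\<in>UNIV. \<xi> i p *\<^sub>R Fi i)"
    "sG S p = (\<Sum>i\<in>UNIV. \<xi> i p *\<^sub>R Gi i)"
  using polytopic assms by (auto simp: polytopic_def)

lemma weights_const: "p \<in> pset S \<Longrightarrow> (\<Sum>i\<in>UNIV. \<xi> i p * c) = c"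
  using weights by (simp add: sum_distrib_right[symmetric])

lemma weights_const_vec: "p \<in> pset S \<Longrightarrow> (\<Sum>i\<in>UNIV. \<xi> i p *\<^sub>R c) = c" for c :: "real^'n"
  using weights by (simp add: scaleR_sum_left[symmetric])

definition Einv where "Einv = matrix_inv Ebar"

lemma Einv: "Einv *v (Ebar *v z) = z" "Ebar *v (Einv *v z) = z"
  using matrix_inv_mult[OF invertible_Ebar] by (simp_all add: Einv_def matrix_vector_mul_assoc)

context
  fixes P :: "'i \<Rightarrow> real^'nx^'nx" and X :: "'i \<Rightarrow> 'i \<Rightarrow> real^'nx^'nx" and Y :: "'i \<Rightarrow> 'i \<Rightarrow> real^'ny^'nx"
    and Z :: "'i \<Rightarrow> 'i \<Rightarrow> real^'ny^'nf" and \<tau> :: "'i \<Rightarrow> 'i \<Rightarrow> real" and \<kappa>v \<kappa>w \<kappa>\<psi> :: real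
  assumes sol: "lmi_solution S \<Lambda> Ebar Ai Gi Fi P X Y Z \<tau> \<kappa>v \<kappa>w \<kappa>\<psi>"
begin

lemma sym_P: "sym_mat (P i)" and tau_pos: "\<tau> i j > 0"
  and kappa_pos: "\<kappa>v > 0" "\<kappa>w > 0" "\<kappa>\<psi> > 0"
  and lmi: "lmi_pos Ebar (Ai i) (Gi i) (Fi i) (sH S) (sC S) (sD S) \<Lambda>
              (P i) (P j) (X i j) (Y i j) (Z i j) (\<tau> i j) \<kappa>v \<kappa>w \<kappa>\<psi>"
  using sol unfolding lmi_solution_iff_lmi_pos by auto

lemma P_lower_strict: "e \<noteq> 0 \<Longrightarrow> (norm e)\<^sup>2 < e \<bullet> (P i *v e)"
  by (rule lmi_pos_lower[OF lmi])

lemma P_lower: "(norm e)\<^sup>2 \<le> e \<bullet> (P i *v e)"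
  using P_lower_strict[of e i] by (cases "e = 0") auto

lemma P_nonneg: "e \<bullet> (P i *v e) \<ge> 0"
  using P_lower[of e i] by (smt (verit) zero_le_power2)

lemma pos_def_P: "pos_def (P i)"
  unfolding pos_def_def using sym_P P_lower_strict by (smt (verit) zero_le_power2)

lemma invertible_X: "invertible (X i j)"
  using lmi_pos_invertible[OF lmi P_nonneg] .

lemma V_lower: "p \<in> pset S \<Longrightarrow> (norm e)\<^sup>2 \<le> poly_quadratic \<xi> P e p"
  using sum_mono[of UNIV "\<lambda>i. \<xi> i p * (norm e)\<^sup>2" "\<lambda>i. \<xi> i p * (e \<bullet> (P i *v e))"]
  by (simp add: poly_quadratic_eq weights_const mult_left_mono P_lower weights)

lemma V_nonneg: "p \<in> pset S \<Longrightarrow> poly_quadratic \<xi> P e p \<ge> 0"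
  using V_lower[of p e] by (smt (verit) zero_le_power2)

lemma lmi_next:
  assumes "pp \<in> pset S"
  shows "lmi_pos Ebar (Ai i) (Gi i) (Fi i) (sH S) (sC S) (sD S) \<Lambda> (P i)
    (\<Sum>j\<in>UNIV. \<xi> j pp *\<^sub>R P j) (\<Sum>j\<in>UNIV. \<xi> j pp *\<^sub>R X i j) (\<Sum>j\<in>UNIV. \<xi> j pp *\<^sub>R Y i j)
    (\<Sum>j\<in>UNIV. \<xi> j pp *\<^sub>R Z i j) (\<Sum>j\<in>UNIV. \<xi> j pp * \<tau> i j) \<kappa>v \<kappa>w \<kappa>\<psi>"
  using assms by (intro lmi_pos_convex_sum lmi weights)

lemma invertible_X_next: "pp \<in> pset S \<Longrightarrow> invertible (\<Sum>j\<in>UNIV. \<xi> j pp *\<^sub>R X i j)"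
  using lmi_pos_invertible[OF lmi_next] V_nonneg by (simp add: poly_quadratic_matrix)

text \<open>Here \<open>p\<close> plays the role of the next parameter, since the inequality bounds
  its second Lyapunov matrix from above; the current vertex is arbitrary.\<close>

lemma V_upper:
  assumes "p \<in> pset S" "e \<noteq> 0"
  shows "poly_quadratic \<xi> P e p < \<kappa>\<psi> * (norm (Ebar *v e))\<^sup>2"
  unfolding poly_quadratic_matrix using assms by (intro lmi_pos_upper[OF lmi_next])

text \<open>\<open>T\<close> is the denominator of \<open>gain_K\<close>. It is positive because at
  each parameter some weight is positive.\<close>

lemma gain_K_scaled:
  assumes "p \<in> pset S" "pp \<in> pset S"
    and T_def: "T = (\<Sum>i\<in>UNIV. \<xi> i p * (\<Sum>j\<in>UNIV. \<xi> j pp * \<tau> i j))"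
  shows "T > 0"
    and "(\<Sum>i\<in>UNIV. \<xi> i p *\<^sub>R (\<Sum>j\<in>UNIV. \<xi> j pp *\<^sub>R Z i j)) = T *\<^sub>R gain_K \<xi> Z \<tau> pp p"
proof -
  have weight_pos: "\<exists>i. \<xi> i q > 0" if "q \<in> pset S" for q
    using weights[OF that] by (metis less_le sum.neutral zero_neq_one)
  have inner: "(\<Sum>j\<in>UNIV. \<xi> j pp * \<tau> i j) > 0" for i
  proof -
    obtain j where "\<xi> j pp > 0"
      using weight_pos[OF assms(2)] ..
    then show ?thesis
      using tau_pos assms weights by (intro sum_pos2[of _ j]) (auto intro!: mult_nonneg_nonneg less_imp_le[OF tau_pos])
  qed
  show T: "T > 0"
  proof -
    obtain i where "\<xi> i p > 0"
      using weight_pos[OF assms(1)] ..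
    then show ?thesis
      unfolding T_def using inner assms weights
      by (intro sum_pos2[of _ i]) (auto intro!: mult_nonneg_nonneg less_imp_le[OF inner])
  qed
  have "(\<Sum>i\<in>UNIV. \<Sum>j\<in>UNIV. \<xi> i p * \<xi> j pp * \<tau> i j) = T"
    by (simp add: T_def sum_distrib_left mult.assoc)
  then show "(\<Sum>i\<in>UNIV. \<xi> i p *\<^sub>R (\<Sum>j\<in>UNIV. \<xi> j pp *\<^sub>R Z i j)) = T *\<^sub>R gain_K \<xi> Z \<tau> pp p"
    using T by (simp add: gain_K_def scaleR_sum_right)
qed

text \<open>The gain \<open>L\<close> mixes different inverses over the current vertex \<open>i\<close>, so the inequalities
  cannot be summed over \<open>i\<close> at a common successor error.  Instead the successor error is a convex
  combination of the successors at the vertices, and the Lyapunov function is convex.\<close>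

lemma V_decrease:
  assumes slope: "slope_restricted \<Lambda> \<phi>" and pp: "pp \<in> pset S" and p: "p \<in> pset S"
    and step: "error_step S \<phi> (gain_L \<xi> X Y) (gain_K \<xi> Z \<tau>) pp p x v w \<psi> e ep"
  shows "poly_quadratic \<xi> P ep pp - poly_quadratic \<xi> P e p
    \<le> - (norm e)\<^sup>2 + \<kappa>v * (norm v)\<^sup>2 + \<kappa>w * (norm w)\<^sup>2 + \<kappa>\<psi> * (norm \<psi>)\<^sup>2"
proof -
  define K where "K = gain_K \<xi> Z \<tau>"
  define s where "s = phi_tilde S \<phi> K pp p e x w"
  define Pn where "Pn = (\<Sum>j\<in>UNIV. \<xi> j pp *\<^sub>R P j)"
  define Xn where "Xn i = (\<Sum>j\<in>UNIV. \<xi> j pp *\<^sub>R X i j)" for i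
  define Yn where "Yn i = (\<Sum>j\<in>UNIV. \<xi> j pp *\<^sub>R Y i j)" for i
  define Zn where "Zn i = (\<Sum>j\<in>UNIV. \<xi> j pp *\<^sub>R Z i j)" for i
  define tn where "tn i = (\<Sum>j\<in>UNIV. \<xi> j pp * \<tau> i j)" for i
  define L where "L i = matrix_inv (Xn i) ** Yn i" for i
  \<comment> \<open>The successor error at vertex \<open>i\<close> uses the matrices and the gain of
    that vertex but the actual increment \<open>s\<close>, common to all \<open>i\<close>.
    Everything that depends on \<open>i\<close> then averages to the true dynamics.\<close>
  define z where "z i = Einv *v (Ai i *v e - L i *v (sC S *v e) + Gi i *v s - Fi i *v v
    + L i *v (sD S *v w) + \<psi>)" for i
  define T where "T = (\<Sum>i\<in>UNIV. \<xi> i p * tn i)"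
  define h where "h = (sH S - K pp p ** sC S) *v e + (K pp p ** sD S) *v w"
  define N where "N = - (norm e)\<^sup>2 + \<kappa>v * (norm v)\<^sup>2 + \<kappa>w * (norm w)\<^sup>2 + \<kappa>\<psi> * (norm \<psi>)\<^sup>2"
  define r where "r i = tn i *\<^sub>R (sH S *v e) - Zn i *v (sC S *v e) + Zn i *v (sD S *v w)" for i
  note lmi_n = lmi_next[OF pp, folded Pn_def Xn_def Yn_def Zn_def tn_def]
  have XL: "Yn i = Xn i ** L i" for i
    using matrix_inv_mult(2)[OF invertible_X_next[OF pp], of i]
    by (simp add: L_def Xn_def matrix_mul_assoc)
  have mat: "(\<Sum>i\<in>UNIV. \<xi> i p *\<^sub>R M i) *v y = (\<Sum>i\<in>UNIV. \<xi> i p *\<^sub>R (M i *v y))"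
    for M :: "'i \<Rightarrow> real^'p^'q" and y
    by (simp add: sum_matrix_vector_mult scaleR_matrix_vector_assoc)
  have vec: "M *v (\<Sum>i\<in>UNIV. \<xi> i p *\<^sub>R y i) = (\<Sum>i\<in>UNIV. \<xi> i p *\<^sub>R (M *v y i))"
    for M :: "real^'p^'q" and y
    by (simp add: linear_sum[OF matrix_vector_mul_linear] matrix_vector_mult_scaleR)
  have Lp: "gain_L \<xi> X Y pp p = (\<Sum>i\<in>UNIV. \<xi> i p *\<^sub>R L i)"
    by (simp add: gain_L_def L_def Xn_def Yn_def)
  have "Ebar *v ep = sA S p *v e - gain_L \<xi> X Y pp p *v (sC S *v e) + sG S p *v s - sF S p *v v
      + gain_L \<xi> X Y pp p *v (sD S *v w) + \<psi>"
    using step descriptor[OF pp]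
    by (simp add: error_step_def s_def K_def matrix_vector_mult_diff_rdistrib matrix_vector_mul_assoc)
  also have "\<dots> = (\<Sum>i\<in>UNIV. \<xi> i p *\<^sub>R (Ebar *v z i))"
    unfolding system_matrices[OF p] Lp mat z_def Einv
    by (simp add: scaleR_add_right scaleR_diff_right sum.distrib sum_subtractf weights_const_vec[OF p])
  also have "\<dots> = Ebar *v (\<Sum>i\<in>UNIV. \<xi> i p *\<^sub>R z i)"
    by (simp add: vec)
  finally have ep: "ep = (\<Sum>i\<in>UNIV. \<xi> i p *\<^sub>R z i)"
    by (metis Einv(1))
  have "sym_mat Pn"
    unfolding Pn_def by (intro sym_mat_sum sym_mat_scaleR sym_P)
  then have "poly_quadratic \<xi> P ep pp \<le> (\<Sum>i\<in>UNIV. \<xi> i p * (z i \<bullet> (Pn *v z i)))"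
    unfolding poly_quadratic_matrix Pn_def[symmetric] ep
    using weights[OF p] V_nonneg[OF pp, unfolded poly_quadratic_matrix, folded Pn_def]
    by (intro convex_quadratic_sum) auto
  also have "\<dots> \<le> (\<Sum>i\<in>UNIV. \<xi> i p * (e \<bullet> (P i *v e) + N + 2 * tn i * (norm s)\<^sup>2 - 2 * (s \<bullet> (\<Lambda> *v r i))))"
  proof (intro sum_mono mult_left_mono weights p)
    fix i
    show "z i \<bullet> (Pn *v z i) \<le> e \<bullet> (P i *v e) + N + 2 * tn i * (norm s)\<^sup>2 - 2 * (s \<bullet> (\<Lambda> *v r i))"
      using lmi_pos_decrease[OF lmi_n XL, of "z i" i e s v w \<psi>]
      by (simp add: z_def Einv N_def r_def)
  qed
  also have "\<dots> = poly_quadratic \<xi> P e p + N + 2 * T * (norm s)\<^sup>2 - 2 * (s \<bullet> (\<Lambda> *v (\<Sum>i\<in>UNIV. \<xi> i p *\<^sub>R r i)))"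
    unfolding vec inner_sum_right
    by (simp add: poly_quadratic_eq distrib_left right_diff_distrib sum.distrib sum_subtractf
        weights_const[OF p] weights_const[OF p, of N, unfolded mult.commute[of _ N]]
        T_def sum_distrib_left sum_distrib_right mult_ac)
  \<comment> \<open>The averaged sector terms are \<open>T\<close> times the sector term of the gain
    \<open>K\<close> actually used, so one application of the slope restriction removes
    them.\<close>
  also have "(\<Sum>i\<in>UNIV. \<xi> i p *\<^sub>R r i) = T *\<^sub>R h"
  proof -
    have "(\<Sum>i\<in>UNIV. \<xi> i p *\<^sub>R r i) = T *\<^sub>R (sH S *v e) - (\<Sum>i\<in>UNIV. \<xi> i p *\<^sub>R Zn i) *v (sC S *v e)
        + (\<Sum>i\<in>UNIV. \<xi> i p *\<^sub>R Zn i) *v (sD S *v w)"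
      unfolding mat r_def T_def
      by (simp add: scaleR_add_right scaleR_diff_right sum.distrib sum_subtractf scaleR_sum_left)
    also have "(\<Sum>i\<in>UNIV. \<xi> i p *\<^sub>R Zn i) = T *\<^sub>R K pp p"
      unfolding Zn_def K_def by (rule gain_K_scaled[OF p pp T_def[unfolded tn_def]])
    finally show ?thesis
      by (simp add: h_def scaleR_matrix_vector_assoc[symmetric] matrix_vector_mult_diff_rdistrib
          matrix_vector_mul_assoc[symmetric] scaleR_add_right scaleR_diff_right)
  qed
  finally have "poly_quadratic \<xi> P ep pp \<le>
      poly_quadratic \<xi> P e p + N + 2 * T * (norm s)\<^sup>2 - 2 * (s \<bullet> (\<Lambda> *v (T *\<^sub>R h)))" .
  moreover have "2 * T * (norm s)\<^sup>2 - 2 * (s \<bullet> (\<Lambda> *v (T *\<^sub>R h))) \<le> 0"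
  proof -
    have "T > 0"
      by (rule gain_K_scaled[OF p pp T_def[unfolded tn_def]])
    moreover have "(norm s)\<^sup>2 \<le> s \<bullet> (\<Lambda> *v h)"
      unfolding h_def by (rule phi_tilde_sector[OF slope s_def])
    ultimately show ?thesis
      by (simp add: matrix_vector_mult_scaleR)
  qed
  ultimately show ?thesis
    by (simp add: N_def)
qed

text \<open>The constant \<open>a\<close> is left open because it is taken from the largest as well
  as from the smallest singular value.\<close>

lemma iss_lyapunov_gains:
  assumes "\<And>e p. p \<in> pset S \<Longrightarrow> poly_quadratic \<xi> P e p \<le> a * (norm e)\<^sup>2"
  shows "iss_lyapunov S \<Lambda> (gain_L \<xi> X Y) (gain_K \<xi> Z \<tau>) (poly_quadratic \<xi> P) a \<kappa>v \<kappa>w \<kappa>\<psi>"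
  unfolding iss_lyapunov_def using assms V_lower V_decrease by blast

section \<open>Bounds by the extremal singular values of the descriptor matrix\<close>

lemma V_le_sigma_max:
  assumes "p \<in> pset S"
  shows "poly_quadratic \<xi> P e p \<le> \<kappa>\<psi> * (sigma_max Ebar)\<^sup>2 * (norm e)\<^sup>2"
proof (cases "e = 0")
  case False
  have "(norm (Ebar *v e))\<^sup>2 \<le> (sigma_max Ebar * norm e)\<^sup>2"
    by (intro power_mono sigma_max_ge) auto
  then have "\<kappa>\<psi> * (norm (Ebar *v e))\<^sup>2 \<le> \<kappa>\<psi> * (sigma_max Ebar * norm e)\<^sup>2"
    using kappa_pos by simp
  then show ?thesis
    using V_upper[OF assms False] by (simp add: power_mult_distrib mult.assoc)
qed (simp add: poly_quadratic_eq)

text \<open>Each \<open>z \<bullet> (P i *v z)\<close> lies strictly between the squared norm of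
  \<open>z\<close> and the claimed quantity. Unit vectors attaining the extremal singular values
  then give both bounds below.\<close>

lemma kappa_norm_gt_1:
  assumes "norm z = 1"
  shows "\<kappa>\<psi> * (norm (Ebar *v z))\<^sup>2 > 1"
proof -
  have "z \<noteq> 0"
    using assms by auto
  then have "(norm z)\<^sup>2 < z \<bullet> (P i *v z)" "z \<bullet> (P i *v z) < \<kappa>\<psi> * (norm (Ebar *v z))\<^sup>2" for i
    using P_lower_strict lmi_pos_upper[OF lmi] by auto
  then show ?thesis
    using assms by (metis less_trans one_power2)
qed

lemma kappa_sigma_min: "\<kappa>\<psi> * (sigma_min Ebar)\<^sup>2 > 1"
  using sigma_min_attained[of Ebar] kappa_norm_gt_1 by metis

lemma kappa_sigma_max: "\<kappa>\<psi> * (sigma_max Ebar)\<^sup>2 > 1"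
  using sigma_max_attained[of Ebar] kappa_norm_gt_1 by metis

end

lemma sigma_nonneg: "sigma_min Ebar \<ge> 0" "sigma_max Ebar \<ge> 0"
  using sigma_min_attained[of Ebar] sigma_max_attained[of Ebar] by (metis norm_ge_zero)+

lemma guarantee_sigma_max:
  assumes sol: "lmi_solution S \<Lambda> Ebar Ai Gi Fi P X Y Z \<tau> \<kappa>v \<kappa>w \<kappa>\<psi>" and "slope_restricted \<Lambda> \<phi>"
  shows "iss_guarantee S \<phi> \<Lambda> \<xi> (gain_L \<xi> X Y) (gain_K \<xi> Z \<tau>) P \<kappa>v \<kappa>w \<kappa>\<psi> (sigma_max Ebar)"
proof -
  have "sigma_max Ebar > 0"
    using sigma_nonneg(2) kappa_sigma_max[OF sol] by (cases "sigma_max Ebar = 0") auto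
  then show ?thesis
    using assms kappa_pos[OF sol] kappa_sigma_max[OF sol] V_le_sigma_max[OF sol]
    by (intro lyapunov_imp_iss_guarantee iss_lyapunov_gains[OF sol]) auto
qed

lemma guarantee_sigma_min:
  assumes sol: "lmi_solution S \<Lambda> Ebar Ai Gi Fi P X Y Z \<tau> \<kappa>v \<kappa>w \<kappa>\<psi>" and slope: "slope_restricted \<Lambda> \<phi>"
  shows "\<exists>\<kappa>0\<ge>\<kappa>\<psi>. \<forall>\<kappa>\<ge>\<kappa>0.
           lmi_solution S \<Lambda> Ebar Ai Gi Fi P X Y Z \<tau> \<kappa>v \<kappa>w \<kappa> \<and>
           iss_guarantee S \<phi> \<Lambda> \<xi> (gain_L \<xi> X Y) (gain_K \<xi> Z \<tau>) P \<kappa>v \<kappa>w \<kappa> (sigma_min Ebar)"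
\<comment> \<open>The second entry is the least \<open>\<kappa>\<close> for which
  \<open>\<kappa> * (sigma_min Ebar)\<^sup>2\<close> dominates the bound by the largest singular
  value; the first keeps the matrix inequalities valid.\<close>
proof (intro exI[of _ "max \<kappa>\<psi> (\<kappa>\<psi> * (sigma_max Ebar)\<^sup>2 / (sigma_min Ebar)\<^sup>2)"] conjI allI impI)
  have pos: "sigma_min Ebar > 0"
    using sigma_nonneg(1) kappa_sigma_min[OF sol] by (cases "sigma_min Ebar = 0") auto
  fix \<kappa>
  assume k: "max \<kappa>\<psi> (\<kappa>\<psi> * (sigma_max Ebar)\<^sup>2 / (sigma_min Ebar)\<^sup>2) \<le> \<kappa>"
  then show sol': "lmi_solution S \<Lambda> Ebar Ai Gi Fi P X Y Z \<tau> \<kappa>v \<kappa>w \<kappa>"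
    by (intro lmi_solution_mono[OF sol]) simp
  have "\<kappa>\<psi> * (sigma_max Ebar)\<^sup>2 \<le> \<kappa> * (sigma_min Ebar)\<^sup>2"
    using k pos by (simp add: pos_divide_le_eq)
  then have "poly_quadratic \<xi> P e p \<le> \<kappa> * (sigma_min Ebar)\<^sup>2 * (norm e)\<^sup>2" if "p \<in> pset S" for e p
    using V_le_sigma_max[OF sol that, of e] by (meson mult_right_mono order_trans zero_le_power2)
  then show "iss_guarantee S \<phi> \<Lambda> \<xi> (gain_L \<xi> X Y) (gain_K \<xi> Z \<tau>) P \<kappa>v \<kappa>w \<kappa> (sigma_min Ebar)"
    using pos slope kappa_pos[OF sol'] kappa_sigma_min[OF sol']
    by (intro lyapunov_imp_iss_guarantee iss_lyapunov_gains[OF sol']) auto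
qed simp

lemma lmi_solution_imp_abs_iss:
  assumes sol: "lmi_solution S \<Lambda> Ebar Ai Gi Fi P X Y Z \<tau> \<kappa>v \<kappa>w \<kappa>\<psi>"
  shows "abs_poly_quadratic_iss S \<Lambda> \<xi> (gain_L \<xi> X Y) (gain_K \<xi> Z \<tau>)"
  unfolding abs_poly_quadratic_iss_def
  using sym_P[OF sol] kappa_pos[OF sol] kappa_sigma_max[OF sol] V_le_sigma_max[OF sol]
  by (intro exI[of _ P] exI[of _ "\<kappa>\<psi> * (sigma_max Ebar)\<^sup>2"] exI[of _ \<kappa>v] exI[of _ \<kappa>w] exI[of _ \<kappa>\<psi>]
      conjI iss_lyapunov_gains[OF sol]) auto

end

section \<open>From the observer to the matrix inequalities\<close>

text \<open>Every pair in the sector of \<open>\<Lambda>\<close> is interpolated by a linear nonlinearity of rank one.\<close>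

lemma slope_restricted_interpolation:
  fixes h s :: "real^'nf"
  assumes "(norm s)\<^sup>2 \<le> s \<bullet> (\<Lambda> *v h)"
  obtains \<phi> where "slope_restricted \<Lambda> \<phi>" "\<phi> 0 = 0" "\<phi> h = s"
proof
  define c where "c = s \<bullet> (\<Lambda> *v h)"
  \<comment> \<open>The map has rank one and is scaled so that \<open>h\<close> goes to
    \<open>s\<close>. If \<open>c = 0\<close>, the hypothesis forces \<open>s = 0\<close>, and
    division by zero gives the zero map, which fits.\<close>
  define \<phi> where "\<phi> y = ((s \<bullet> (\<Lambda> *v y)) / c) *\<^sub>R s" for y
  show "\<phi> 0 = 0"
    by (simp add: \<phi>_def)
  show "\<phi> h = s"
    using assms by (cases "c = 0") (auto simp: \<phi>_def c_def[symmetric])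
  show "slope_restricted \<Lambda> \<phi>"
    unfolding slope_restricted_def
  proof (intro allI)
    fix x y
    define t where "t = s \<bullet> (\<Lambda> *v (y - x))"
    have "\<phi> y - \<phi> x = (t / c) *\<^sub>R s"
      by (simp add: \<phi>_def t_def matrix_vector_mult_diff_distrib inner_diff_right diff_divide_distrib
          scaleR_diff_left)
    moreover have "2 * ((t / c)\<^sup>2 * (norm s)\<^sup>2) \<le> 2 * ((t / c) * t)"
    proof (cases "c = 0")
      case False
      have "(t / c)\<^sup>2 * (norm s)\<^sup>2 \<le> (t / c)\<^sup>2 * c"
        using assms by (intro mult_left_mono) (auto simp: c_def)
      then show ?thesis
        using False by (simp add: power2_eq_square)
    qed simp
    ultimately show "2 * (norm (\<phi> y - \<phi> x))\<^sup>2 - 2 * ((\<phi> y - \<phi> x) \<bullet> (\<Lambda> *v (y - x))) \<le> 0"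
      by (simp add: power_mult_distrib power_divide t_def)
  qed
qed

text \<open>The multiplier \<open>X = P' ** matrix_inv Ebar\<close> turns the matrix inequality into a Schur complement
  of the dissipation inequality.\<close>

lemma lmi_form_multiplier:
  fixes Ebar Einv :: "real^'nx^'nx" and G :: "real^'nf^'nx" and F :: "real^'nv^'nx"
    and D :: "real^'nw^'ny"
  assumes inv: "Einv ** Ebar = mat 1" and sym: "sym_mat P'"
    and r_def: "\<And>e s v w q.
      r e s v w q = Einv *v (A *v e - L *v (C *v e) + G *v s - F *v v + L *v (D *v w) + q)"
  shows "lmi_form Ebar A G F H C D \<Lambda> P P' (P' ** Einv) (P' ** Einv ** L) (\<tau> *\<^sub>R K) \<tau> \<kappa>v \<kappa>w \<kappa>\<psi> z e s v w q =
    (z + r e (- s) v w q) \<bullet> (P' *v (z + r e (- s) v w q))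
    - r e (- s) v w q \<bullet> (P' *v r e (- s) v w q)
    + e \<bullet> (P *v e) - (norm e)\<^sup>2 + \<kappa>v * (norm v)\<^sup>2 + \<kappa>w * (norm w)\<^sup>2 + \<kappa>\<psi> * (norm q)\<^sup>2
    + 2 * \<tau> * ((norm s)\<^sup>2 - (- s) \<bullet> (\<Lambda> *v (H *v e - K *v (C *v e) + K *v (D *v w))))"
proof -
  have E: "Einv *v (Ebar *v z) = z"
    using inv by (simp add: matrix_vector_mul_assoc)
  have r: "Einv *v (A *v e - L *v (C *v e) - G *v s - F *v v + L *v (D *v w) + q) = r e (- s) v w q"
    by (simp add: r_def linear_neg[OF matrix_vector_mul_linear])
  have "2 * (z \<bullet> ((P' ** Einv) *v (A *v e) - (P' ** Einv ** L) *v (C *v e) - (P' ** Einv) *v (G *v s)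
      - (P' ** Einv) *v (F *v v) + (P' ** Einv ** L) *v (D *v w) + (P' ** Einv) *v q))
     = 2 * (z \<bullet> (P' *v r e (- s) v w q))"
    unfolding matrix_vector_mul_assoc[symmetric] matrix_vector_right_distrib[symmetric]
      matrix_vector_mult_diff_distrib[symmetric] r ..
  moreover have "2 * (z \<bullet> ((P' ** Einv) *v (Ebar *v z))) = 2 * (z \<bullet> (P' *v z))"
    by (simp add: matrix_vector_mul_assoc[symmetric] E)
  moreover have "2 * (s \<bullet> (\<Lambda> *v (\<tau> *\<^sub>R (H *v e) - (\<tau> *\<^sub>R K) *v (C *v e) + (\<tau> *\<^sub>R K) *v (D *v w))))
     = 2 * \<tau> * (s \<bullet> (\<Lambda> *v (H *v e - K *v (C *v e) + K *v (D *v w))))"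
    by (simp add: scaleR_matrix_vector_assoc[symmetric] matrix_vector_right_distrib
        matrix_vector_mult_diff_distrib matrix_vector_mult_scaleR inner_add_right inner_diff_right
        algebra_simps)
  \<comment> \<open>Completing the square in \<open>z\<close>: the terms with \<open>X\<close> and
    \<open>P'\<close> sum to \<open>z \<bullet> (P' *v z)\<close> plus twice the mixed term.\<close>
  moreover have "(z + r e (- s) v w q) \<bullet> (P' *v (z + r e (- s) v w q)) =
      z \<bullet> (P' *v z) + 2 * (z \<bullet> (P' *v r e (- s) v w q)) + r e (- s) v w q \<bullet> (P' *v r e (- s) v w q)"
    using symmetric_inner[OF sym, of "r e (- s) v w q" z]
    by (simp add: matrix_vector_right_distrib inner_add_left inner_add_right)
  ultimately show ?thesis
    unfolding lmi_form_def by (simp add: algebra_simps)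
qed

context constant_descriptor_system
begin

text \<open>Doubling the Lyapunov function makes the dissipation inequality strict, as required by the
  strict S-lemma.\<close>

lemma dissipation_imp_lmi:
  assumes lyap: "iss_lyapunov S \<Lambda> L K (poly_quadratic \<xi> P) a \<kappa>v \<kappa>w \<kappa>\<psi>"
    and sym: "\<And>i. sym_mat (P i)"
    and p: "p \<in> pset S" "\<And>k. \<xi> k p = (if k = i then 1 else 0)"
    and pp: "pp \<in> pset S" "\<And>k. \<xi> k pp = (if k = j then 1 else 0)"
  defines "X \<equiv> (2 *\<^sub>R P j) ** Einv"
  obtains \<tau> where "\<tau> > 0"
    "lmi_pos Ebar (Ai i) (Gi i) (Fi i) (sH S) (sC S) (sD S) \<Lambda> (2 *\<^sub>R P i) (2 *\<^sub>R P j)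
       X (X ** L pp p) (\<tau> *\<^sub>R K pp p) \<tau> (2 * \<kappa>v + 1) (2 * \<kappa>w + 1) (2 * \<kappa>\<psi> + 1)"
proof -
  have vertex: "(\<Sum>k\<in>UNIV. (if k = l then 1 else 0) *\<^sub>R M k) = M l" for M :: "'i \<Rightarrow> 'z::real_vector" and l
  proof -
    have "(\<Sum>k\<in>UNIV. (if k = l then 1 else 0 :: real) *\<^sub>R M k) = (\<Sum>k\<in>UNIV. if k = l then M k else 0)"
      by (intro sum.cong) auto
    then show ?thesis
      by simp
  qed
  have V: "poly_quadratic \<xi> P e p = e \<bullet> (P i *v e)" "poly_quadratic \<xi> P e pp = e \<bullet> (P j *v e)" for e
    unfolding poly_quadratic_matrix p(2) pp(2) vertex by auto
  have mats: "sA S p = Ai i" "sF S p = Fi i" "sG S p = Gi i"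
    unfolding system_matrices[OF p(1)] p(2) vertex by auto
  define h where "h e w = sH S *v e - K pp p *v (sC S *v e) + K pp p *v (sD S *v w)" for e w
  define r where "r e s v w q = Einv *v (Ai i *v e - L pp p *v (sC S *v e) + Gi i *v s - Fi i *v v
    + L pp p *v (sD S *v w) + q)" for e s v w q
  \<comment> \<open>Twice the slack of the dissipation inequality plus the squared norms of
    \<open>e\<close>, \<open>v\<close>, \<open>w\<close> and \<open>q\<close>; hence the constants
    \<open>2 * \<kappa> + 1\<close> and a single \<open>(norm e)\<^sup>2\<close>.\<close>
  define q0 where "q0 = (\<lambda>(e, s :: real^'nf, v, w, q). 2 * (e \<bullet> (P i *v e)) - (norm e)\<^sup>2
    + (2 * \<kappa>v + 1) * (norm v)\<^sup>2 + (2 * \<kappa>w + 1) * (norm w)\<^sup>2 + (2 * \<kappa>\<psi> + 1) * (norm q)\<^sup>2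
    - 2 * (r e s v w q \<bullet> (P j *v r e s v w q)))"
  define q1 where "q1 = (\<lambda>(e, s, v :: real^'nv, w, q :: real^'nx). s \<bullet> (\<Lambda> *v h e w) - (norm s)\<^sup>2)"
  have dissipation: "r e s v w q \<bullet> (P j *v r e s v w q) - e \<bullet> (P i *v e)
      \<le> - (norm e)\<^sup>2 + \<kappa>v * (norm v)\<^sup>2 + \<kappa>w * (norm w)\<^sup>2 + \<kappa>\<psi> * (norm q)\<^sup>2"
    if sector: "(norm s)\<^sup>2 \<le> s \<bullet> (\<Lambda> *v h e w)" for e s v w q
  proof -
    obtain \<phi> where phi: "slope_restricted \<Lambda> \<phi>" "\<phi> 0 = 0" "\<phi> (h e w) = s"
      using slope_restricted_interpolation[OF sector] .
    \<comment> \<open>At the state zero, \<open>\<phi> 0 = 0\<close> reduces the increment to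
      \<open>\<phi> (h e w)\<close>.\<close>
    have "phi_tilde S \<phi> K pp p e 0 w = s"
      using phi by (simp add: phi_tilde_def h_def matrix_vector_mult_diff_rdistrib
          matrix_vector_mul_assoc[symmetric])
    then have "error_step S \<phi> L K pp p 0 v w q e (r e s v w q)"
      using descriptor[OF pp(1)] by (simp add: error_step_def r_def Einv mats
          matrix_vector_mult_diff_rdistrib matrix_vector_mul_assoc[symmetric])
    then show ?thesis
      using lyap phi(1) p(1) pp(1) unfolding iss_lyapunov_def V[symmetric] by blast
  qed
  have lin_h: "linear (\<lambda>(e, s :: real^'nf, v :: real^'nv, w, q :: real^'nx). h e w)"
    by (rule linearI) (auto simp: h_def matrix_vector_right_distrib matrix_vector_mult_scaleR
        scaleR_add_right scaleR_diff_right)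
  have lin_r: "linear (\<lambda>(e, s, v, w, q). r e s v w q)"
    by (rule linearI) (auto simp: r_def matrix_vector_right_distrib matrix_vector_mult_diff_distrib
        matrix_vector_mult_scaleR scaleR_add_right scaleR_diff_right)
  have lin:
    "linear (\<lambda>(e :: real^'nx, s :: real^'nf, v :: real^'nv, w :: real^'nw, q :: real^'nx). e)"
    "linear (\<lambda>(e :: real^'nx, s :: real^'nf, v :: real^'nv, w :: real^'nw, q :: real^'nx). s)"
    "linear (\<lambda>(e :: real^'nx, s :: real^'nf, v :: real^'nv, w :: real^'nw, q :: real^'nx). v)"
    "linear (\<lambda>(e :: real^'nx, s :: real^'nf, v :: real^'nv, w :: real^'nw, q :: real^'nx). w)"
    "linear (\<lambda>(e :: real^'nx, s :: real^'nf, v :: real^'nv, w :: real^'nw, q :: real^'nx). q)"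
    by (rule linearI; auto)+
  have form0: "quadratic_form q0"
    using quadratic_form_diff[OF
        quadratic_form_add[OF quadratic_form_add[OF quadratic_form_add[OF quadratic_form_diff[OF
              quadratic_form_cmult[OF quadratic_form_inner[OF lin(1) linear_matrix_vector_mult_compose[OF lin(1)]]]
              quadratic_form_norm[OF lin(1)]]
            quadratic_form_cmult[OF quadratic_form_norm[OF lin(3)]]]
          quadratic_form_cmult[OF quadratic_form_norm[OF lin(4)]]]
          quadratic_form_cmult[OF quadratic_form_norm[OF lin(5)]]]
        quadratic_form_cmult[OF quadratic_form_inner[OF lin_r linear_matrix_vector_mult_compose[OF lin_r]]]]
    unfolding q0_def by (simp add: split_def)
  have form1: "quadratic_form q1"
    using quadratic_form_diff[OF quadratic_form_inner[OF lin(2) linear_matrix_vector_mult_compose[OF lin_h]]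
        quadratic_form_norm[OF lin(2)]]
    unfolding q1_def by (simp add: split_def)
  have strict: "q0 z > 0" if "z \<noteq> 0" "q1 z \<ge> 0" for z
  proof -
    obtain e s v w q where z: "z = (e, s, v, w, q)"
      by (cases z)
    have sector: "(norm s)\<^sup>2 \<le> s \<bullet> (\<Lambda> *v h e w)"
      using that(2) by (simp add: z q1_def)
    have "q0 z \<ge> (norm e)\<^sup>2 + (norm v)\<^sup>2 + (norm w)\<^sup>2 + (norm q)\<^sup>2"
      using dissipation[OF sector, of v q] by (simp add: q0_def z algebra_simps)
    moreover have "(norm e)\<^sup>2 + (norm v)\<^sup>2 + (norm w)\<^sup>2 + (norm q)\<^sup>2 > 0"
    proof (rule ccontr)
      assume "\<not> ?thesis"
      then have "(norm e)\<^sup>2 = 0 \<and> (norm v)\<^sup>2 = 0 \<and> (norm w)\<^sup>2 = 0 \<and> (norm q)\<^sup>2 = 0"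
        by (smt (verit) zero_le_power2)
      then have "e = 0" "v = 0" "w = 0" "q = 0"
        by auto
      \<comment> \<open>No squared norm of \<open>s\<close> was added to \<open>q0\<close>: once
        \<open>e\<close> and \<open>w\<close> vanish, so does \<open>h e w\<close>, and the sector
        inequality forces \<open>s = 0\<close>.\<close>
      then show False
        using that(1) sector by (auto simp: z h_def zero_prod_def)
    qed
    ultimately show ?thesis
      by linarith
  qed
  obtain t where t: "t > 0" "\<And>z. z \<noteq> 0 \<Longrightarrow> q0 z - t * q1 z > 0"
    using S_lemma_strict[OF form0 form1 strict] by metis
  have P_pos: "z \<bullet> (P j *v z) \<ge> (norm z)\<^sup>2" for z
    using lyap pp(1) unfolding iss_lyapunov_def V[symmetric] by blast
  show ?thesis
  proof (rule that)
    \<comment> \<open>The form contains the sector term with the factor \<open>2 * \<tau>\<close>,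
      so the S-lemma multiplier is halved.\<close>
    show "t / 2 > 0"
      using t by simp
    show "lmi_pos Ebar (Ai i) (Gi i) (Fi i) (sH S) (sC S) (sD S) \<Lambda> (2 *\<^sub>R P i) (2 *\<^sub>R P j)
       X (X ** L pp p) ((t / 2) *\<^sub>R K pp p) (t / 2) (2 * \<kappa>v + 1) (2 * \<kappa>w + 1) (2 * \<kappa>\<psi> + 1)"
      unfolding lmi_pos_def
    proof (intro allI impI)
      fix z e q :: "real^'nx" and s :: "real^'nf" and v :: "real^'nv" and w :: "real^'nw"
      assume nz: "(z, e, s, v, w, q) \<noteq> (0, 0, 0, 0, 0, 0)"
      \<comment> \<open>The completed square separates \<open>z\<close> from the other blocks. If
        those vanish, then \<open>y = z\<close> is nonzero and \<open>P j\<close> decides; otherwise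
        the S-lemma does.\<close>
      define y where "y = z + r e (- s) v w q"
      have Einv_mult: "Einv ** Ebar = mat 1"
        unfolding Einv_def by (rule matrix_inv_mult[OF invertible_Ebar])
      have "lmi_form Ebar (Ai i) (Gi i) (Fi i) (sH S) (sC S) (sD S) \<Lambda> (2 *\<^sub>R P i) (2 *\<^sub>R P j)
         X (X ** L pp p) ((t / 2) *\<^sub>R K pp p) (t / 2) (2 * \<kappa>v + 1) (2 * \<kappa>w + 1) (2 * \<kappa>\<psi> + 1) z e s v w q
        = 2 * (y \<bullet> (P j *v y)) + (q0 (e, - s, v, w, q) - t * q1 (e, - s, v, w, q))"
        unfolding X_def lmi_form_multiplier[OF Einv_mult sym_mat_scaleR[OF sym] r_def]
          y_def[symmetric] h_def[symmetric]
        by (simp add: q0_def q1_def scaleR_matrix_vector_assoc[symmetric] algebra_simps)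
      moreover have "2 * (y \<bullet> (P j *v y)) + (q0 (e, - s, v, w, q) - t * q1 (e, - s, v, w, q)) > 0"
      proof (cases "(e, - s, v, w, q) = 0")
        case True
        then have "e = 0" "s = 0" "v = 0" "w = 0" "q = 0"
          by (auto simp: zero_prod_def)
        with nz have "z \<noteq> 0" "y = z"
          by (auto simp: y_def r_def)
        then have "y \<bullet> (P j *v y) > 0"
          using P_pos[of y] by (smt (verit) zero_less_norm_iff zero_less_power)
        then show ?thesis
          unfolding True using quadratic_form_zero[OF form0] quadratic_form_zero[OF form1] by simp
      next
        case False
        have "y \<bullet> (P j *v y) \<ge> 0"
          using P_pos[of y] by (smt (verit) zero_le_power2)
        then show ?thesis
          using t(2)[OF False] by simp
      qed
      ultimately show "lmi_form Ebar (Ai i) (Gi i) (Fi i) (sH S) (sC S) (sD S) \<Lambda> (2 *\<^sub>R P i) (2 *\<^sub>R P j)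
         X (X ** L pp p) ((t / 2) *\<^sub>R K pp p) (t / 2) (2 * \<kappa>v + 1) (2 * \<kappa>w + 1) (2 * \<kappa>\<psi> + 1) z e s v w q > 0"
        by simp
    qed
  qed
qed

lemma abs_iss_imp_lmi_solution:
  assumes vertices: "range (\<lambda>i. axis i 1) \<subseteq> (\<lambda>p. \<chi> i. \<xi> i p) ` pset S"
    and iss: "abs_poly_quadratic_iss S \<Lambda> \<xi> L K"
  shows "\<exists>P X Y Z \<tau> \<kappa>v \<kappa>w \<kappa>\<psi>. lmi_solution S \<Lambda> Ebar Ai Gi Fi P X Y Z \<tau> \<kappa>v \<kappa>w \<kappa>\<psi>"
proof -
  obtain P a \<kappa>v \<kappa>w \<kappa>\<psi> where sym: "\<And>i. sym_mat (P i)" and pos: "\<kappa>v > 0" "\<kappa>w > 0" "\<kappa>\<psi> > 0"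
    and lyap: "iss_lyapunov S \<Lambda> L K (poly_quadratic \<xi> P) a \<kappa>v \<kappa>w \<kappa>\<psi>"
    using iss unfolding abs_poly_quadratic_iss_def by blast
  have "\<exists>p\<in>pset S. \<forall>k. \<xi> k p = (if k = i then 1 else 0)" for i
  proof -
    obtain p where "p \<in> pset S" "axis i 1 = (\<chi> i. \<xi> i p)"
      using vertices by blast
    then show ?thesis
      by (intro bexI[of _ p]) (auto simp: vec_eq_iff axis_def)
  qed
  then obtain p where p: "\<And>i. p i \<in> pset S" "\<And>i k. \<xi> k (p i) = (if k = i then 1 else 0)"
    by metis
  \<comment> \<open>This multiplier depends on the next vertex only; the current vertex enters
    through the gains evaluated at \<open>p j\<close> and \<open>p i\<close>.\<close>
  define X where "X j = (2 *\<^sub>R P j) ** Einv" for j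
  have "\<exists>\<tau>>0. lmi_pos Ebar (Ai i) (Gi i) (Fi i) (sH S) (sC S) (sD S) \<Lambda> (2 *\<^sub>R P i) (2 *\<^sub>R P j)
       (X j) (X j ** L (p j) (p i)) (\<tau> *\<^sub>R K (p j) (p i)) \<tau> (2 * \<kappa>v + 1) (2 * \<kappa>w + 1) (2 * \<kappa>\<psi> + 1)" for i j
    using dissipation_imp_lmi[OF lyap sym p p, of i j] unfolding X_def by metis
  then obtain \<tau> where "\<And>i j. \<tau> i j > 0" "\<And>i j. lmi_pos Ebar (Ai i) (Gi i) (Fi i) (sH S) (sC S) (sD S)
       \<Lambda> (2 *\<^sub>R P i) (2 *\<^sub>R P j) (X j) (X j ** L (p j) (p i)) (\<tau> i j *\<^sub>R K (p j) (p i)) (\<tau> i j)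
       (2 * \<kappa>v + 1) (2 * \<kappa>w + 1) (2 * \<kappa>\<psi> + 1)"
    by metis
  then have "lmi_solution S \<Lambda> Ebar Ai Gi Fi (\<lambda>i. 2 *\<^sub>R P i) (\<lambda>i j. X j) (\<lambda>i j. X j ** L (p j) (p i))
      (\<lambda>i j. \<tau> i j *\<^sub>R K (p j) (p i)) \<tau> (2 * \<kappa>v + 1) (2 * \<kappa>w + 1) (2 * \<kappa>\<psi> + 1)"
    unfolding lmi_solution_iff_lmi_pos using pos by (auto intro: sym_mat_scaleR sym)
  then show ?thesis
    by blast
qed

end

theorem theorem2:
  fixes S :: "('np::finite, 'nx::finite, 'nu::finite, 'ny::finite, 'nv::finite, 'nw::finite, 'nf::finite) lpv_system"
    and \<phi> :: "real^'nf \<Rightarrow> real^'nf" and \<Lambda> :: "real^'nf^'nf"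
    and \<xi> :: "'i::finite \<Rightarrow> real^'np \<Rightarrow> real"
    and Ei Ai :: "'i \<Rightarrow> real^'nx^'nx" and Bi :: "'i \<Rightarrow> real^'nu^'nx"
    and Fi :: "'i \<Rightarrow> real^'nv^'nx" and Gi :: "'i \<Rightarrow> real^'nf^'nx"
    and Ebar :: "real^'nx^'nx"
  assumes "compact (pset S)"
    and "polytopic S \<xi> Ei Ai Bi Fi Gi"
    and "pos_def \<Lambda>" and "slope_restricted \<Lambda> \<phi>"
    and "invertible Ebar" and "\<forall>p\<in>pset S. sE S p = Ebar"
    and "range (\<lambda>i. axis i 1) \<subseteq> (\<lambda>p. \<chi> i. \<xi> i p) ` pset S"
  shows
    "((\<exists>L K. abs_poly_quadratic_iss S \<Lambda> \<xi> L K) \<longleftrightarrow>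
      (\<exists>P X Y Z \<tau> \<kappa>v \<kappa>w \<kappa>\<psi>. lmi_solution S \<Lambda> Ebar Ai Gi Fi P X Y Z \<tau> \<kappa>v \<kappa>w \<kappa>\<psi>))
     \<and>
     (\<forall>P X Y Z \<tau> \<kappa>v \<kappa>w \<kappa>\<psi>. lmi_solution S \<Lambda> Ebar Ai Gi Fi P X Y Z \<tau> \<kappa>v \<kappa>w \<kappa>\<psi> \<longrightarrow>
        (\<forall>i. pos_def (P i)) \<and>
        (\<forall>i j. invertible (X i j)) \<and>
        (\<forall>i. \<forall>pp\<in>pset S. invertible (\<Sum>j\<in>UNIV. \<xi> j pp *\<^sub>R X i j)) \<and>
        abs_poly_quadratic_iss S \<Lambda> \<xi> (gain_L \<xi> X Y) (gain_K \<xi> Z \<tau>) \<and>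
        iss_guarantee S \<phi> \<Lambda> \<xi> (gain_L \<xi> X Y) (gain_K \<xi> Z \<tau>) P \<kappa>v \<kappa>w \<kappa>\<psi> (sigma_max Ebar) \<and>
        \<kappa>\<psi> * (sigma_min Ebar)\<^sup>2 > 1 \<and>
        (\<exists>\<kappa>0\<ge>\<kappa>\<psi>. \<forall>\<kappa>\<ge>\<kappa>0.
           lmi_solution S \<Lambda> Ebar Ai Gi Fi P X Y Z \<tau> \<kappa>v \<kappa>w \<kappa> \<and>
           iss_guarantee S \<phi> \<Lambda> \<xi> (gain_L \<xi> X Y) (gain_K \<xi> Z \<tau>) P \<kappa>v \<kappa>w \<kappa> (sigma_min Ebar)))"
proof -
  interpret constant_descriptor_system S \<xi> Ei Ai Bi Fi Gi Ebar \<Lambda>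
    using assms(2,5,6) by unfold_locales auto
  show ?thesis
  proof (intro conjI iffI allI impI)
    assume "\<exists>L K. abs_poly_quadratic_iss S \<Lambda> \<xi> L K"
    then show "\<exists>P X Y Z \<tau> \<kappa>v \<kappa>w \<kappa>\<psi>. lmi_solution S \<Lambda> Ebar Ai Gi Fi P X Y Z \<tau> \<kappa>v \<kappa>w \<kappa>\<psi>"
      using abs_iss_imp_lmi_solution[OF assms(7)] by blast
  next
    assume "\<exists>P X Y Z \<tau> \<kappa>v \<kappa>w \<kappa>\<psi>. lmi_solution S \<Lambda> Ebar Ai Gi Fi P X Y Z \<tau> \<kappa>v \<kappa>w \<kappa>\<psi>"
    then show "\<exists>L K. abs_poly_quadratic_iss S \<Lambda> \<xi> L K"
      using lmi_solution_imp_abs_iss by blast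
  next
    fix P X Y Z \<tau> \<kappa>v \<kappa>w \<kappa>\<psi>
    assume sol: "lmi_solution S \<Lambda> Ebar Ai Gi Fi P X Y Z \<tau> \<kappa>v \<kappa>w \<kappa>\<psi>"
    show "pos_def (P i)" "invertible (X i j)" for i j
      by (rule pos_def_P[OF sol] invertible_X[OF sol])+
    show "\<forall>pp\<in>pset S. invertible (\<Sum>j\<in>UNIV. \<xi> j pp *\<^sub>R X i j)" for i
      using invertible_X_next[OF sol] by blast
    show "abs_poly_quadratic_iss S \<Lambda> \<xi> (gain_L \<xi> X Y) (gain_K \<xi> Z \<tau>)"
      by (rule lmi_solution_imp_abs_iss[OF sol])
    show "iss_guarantee S \<phi> \<Lambda> \<xi> (gain_L \<xi> X Y) (gain_K \<xi> Z \<tau>) P \<kappa>v \<kappa>w \<kappa>\<psi> (sigma_max Ebar)"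
      by (rule guarantee_sigma_max[OF sol assms(4)])
    show "\<kappa>\<psi> * (sigma_min Ebar)\<^sup>2 > 1"
      by (rule kappa_sigma_min[OF sol])
    show "\<exists>\<kappa>0\<ge>\<kappa>\<psi>. \<forall>\<kappa>\<ge>\<kappa>0.
           lmi_solution S \<Lambda> Ebar Ai Gi Fi P X Y Z \<tau> \<kappa>v \<kappa>w \<kappa> \<and>
           iss_guarantee S \<phi> \<Lambda> \<xi> (gain_L \<xi> X Y) (gain_K \<xi> Z \<tau>) P \<kappa>v \<kappa>w \<kappa> (sigma_min Ebar)"
      by (rule guarantee_sigma_min[OF sol assms(4)])
  qed
qed

end
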